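(* Let $M$ be a smooth, closed, oriented manifold of dimension $n$ and let $g_0,g_1\in\mathcal{M}$. Then for any measurable subset $Y\subseteq M$, $$\left|\sqrt{\operatorname{Vol}(Y,g_1)}-\sqrt{\operatorname{Vol}(Y,g_0)}\right|\le\frac{\sqrt n}{4}\,d(g_0,g_1).$$
   Context: $\mathcal{S}$ is the Fréchet space of smooth symmetric $(0,2)$-tensor fields on $M$ and $\mathcal{M}\subset\mathcal{S}$ the open subset of smooth Riemannian metrics. The $L^2$ metric on $\mathcal{M}$ is $(h,k)_{\tilde g}=\int_M\operatorname{tr}(\tilde g^{-1}h\tilde g^{-1}k)\,\mu_{\tilde g}$ for $h,k\in\mathcal{S}\cong T_{\tilde g}\mathcal{M}$, where $\mu_{\tilde g}$ is the volume form of $\tilde g$. $d(g_0,g_1)$ is the infimum of $\int_0^1\sqrt{(g_t',g_t')_{g_t}}\,dt$ over piecewise $C^1$ paths $g_t$, $t\in[0,1]$, in $\mathcal{M}$ from $g_0$ to $g_1$. $\operatorname{Vol}(Y,\tilde g)=\int_Y\mu_{\tilde g}$. Measurable means Lebesgue measurable. *)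

theory Defs
  imports "HOL-Analysis.Analysis"
begin

section \<open>Smooth functions on open subsets of Euclidean space\<close>

fun iter_partial :: "'n::finite list \<Rightarrow> (real^'n \<Rightarrow> 'b::real_normed_vector) \<Rightarrow> real^'n \<Rightarrow> 'b" where
  "iter_partial [] f = f"
| "iter_partial (i # is) f = iter_partial is (\<lambda>x. frechet_derivative f (at x) (axis i 1))"

text \<open>For open \<open>S\<close> only: all iterated partial derivatives exist and are differentiable, which
  is equivalent to \<open>f\<close> being of class \<open>C\<^sup>k\<close> on \<open>S\<close> for every \<open>k\<close>.\<close>

definition smooth_on :: "(real^'n::finite) set \<Rightarrow> (real^'n \<Rightarrow> 'b::real_normed_vector) \<Rightarrow> bool" where
  "smooth_on S f \<longleftrightarrow> (\<forall>is. iter_partial is f differentiable_on S)"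


section \<open>Closed oriented manifolds\<close>

text \<open>A chart is a domain \<open>U\<close> with a coordinate map \<open>\<phi>\<close>; values of \<open>\<phi>\<close> outside \<open>U\<close> are irrelevant.\<close>

type_synonym ('m, 'n) chart = "'m set \<times> ('m \<Rightarrow> (real, 'n) vec)"

abbreviation dom_of :: "('m, 'n::finite) chart \<Rightarrow> 'm set" where
  "dom_of c \<equiv> fst c"

abbreviation coord :: "('m, 'n::finite) chart \<Rightarrow> 'm \<Rightarrow> real^'n" where
  "coord c \<equiv> snd c"

definition coord_inv :: "('m, 'n::finite) chart \<Rightarrow> real^'n \<Rightarrow> 'm" where
  "coord_inv c = inv_into (dom_of c) (coord c)"

definition transition :: "('m, 'n::finite) chart \<Rightarrow> ('m, 'n) chart \<Rightarrow> real^'n \<Rightarrow> real^'n" where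
  "transition c d = coord d \<circ> coord_inv c"

definition jacobian :: "('m, 'n::finite) chart \<Rightarrow> ('m, 'n) chart \<Rightarrow> 'm \<Rightarrow> real^'n^'n" where
  "jacobian c d p = matrix (frechet_derivative (transition c d) (at (coord c p)))"

text \<open>The smooth structure and the orientation are given by an atlas \<open>A\<close> of positively oriented
  charts, not necessarily a maximal one. The dimension is \<open>CARD('n)\<close>.\<close>

locale oriented_manifold =
  fixes X :: "'m topology" and A :: "('m, 'n::finite) chart set"
  assumes Hausdorff: "Hausdorff_space X"
    and second_countable: "second_countable X"
    and covers: "(\<Union>c\<in>A. dom_of c) = topspace X"
    and open_domain: "c \<in> A \<Longrightarrow> openin X (dom_of c)"
    and open_image: "c \<in> A \<Longrightarrow> open (coord c ` dom_of c)"
    and homeo: "c \<in> A \<Longrightarrow>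
      homeomorphic_map (subtopology X (dom_of c)) (top_of_set (coord c ` dom_of c)) (coord c)"
    and smooth_transition: "c \<in> A \<Longrightarrow> d \<in> A \<Longrightarrow>
      smooth_on (coord c ` (dom_of c \<inter> dom_of d)) (transition c d)"
    and oriented: "c \<in> A \<Longrightarrow> d \<in> A \<Longrightarrow> p \<in> dom_of c \<inter> dom_of d \<Longrightarrow> det (jacobian c d p) > 0"

locale closed_oriented_manifold = oriented_manifold X A
  for X :: "'m topology" and A :: "('m, 'n::finite) chart set" +
  assumes compact: "compact_space X"

definition manifold_lebesgue_measurable :: "'m topology \<Rightarrow> ('m, 'n::finite) chart set \<Rightarrow> 'm set \<Rightarrow> bool" where
  "manifold_lebesgue_measurable X A Y \<longleftrightarrow>
     Y \<subseteq> topspace X \<and> (\<forall>c\<in>A. coord c ` (Y \<inter> dom_of c) \<in> sets lebesgue)"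


section \<open>Symmetric tensor fields and Riemannian metrics\<close>

text \<open>A \<open>(0,2)\<close>-tensor field is given by its component matrices \<open>h c p $ i $ j\<close> in the charts \<open>c\<close>
  of the atlas, subject to the tensor transformation law. The components are set to \<open>0\<close> where they
  have no meaning, so that equality of tensor fields is equality of functions.\<close>

type_synonym ('m, 'n) components = "('m, 'n) chart \<Rightarrow> 'm \<Rightarrow> ((real, 'n) vec, 'n) vec"

definition sym_tensors :: "('m, 'n::finite) chart set \<Rightarrow> ('m, 'n) components set" where
  "sym_tensors A = {h.
     (\<forall>c p. \<not> (c \<in> A \<and> p \<in> dom_of c) \<longrightarrow> h c p = 0) \<and>
     (\<forall>c\<in>A. smooth_on (coord c ` dom_of c) (\<lambda>x. h c (coord_inv c x))) \<and>
     (\<forall>c\<in>A. \<forall>p\<in>dom_of c. transpose (h c p) = h c p) \<and>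
     (\<forall>c\<in>A. \<forall>d\<in>A. \<forall>p\<in>dom_of c \<inter> dom_of d.
        h c p = transpose (jacobian c d p) ** h d p ** jacobian c d p)}"

definition riem_metrics :: "('m, 'n::finite) chart set \<Rightarrow> ('m, 'n) components set" where
  "riem_metrics A =
     {g \<in> sym_tensors A. \<forall>c\<in>A. \<forall>p\<in>dom_of c. \<forall>v. v \<noteq> 0 \<longrightarrow> v \<bullet> (g c p *v v) > 0}"


section \<open>Integration of top-degree forms\<close>

text \<open>An \<open>n\<close>-form \<open>\<omega>\<close> is represented by its coefficients: \<open>\<omega> = \<omega> c dx\<^sub>1 \<and> \<dots> \<and> dx\<^sub>n\<close> in the chart \<open>c\<close>.
  To integrate over a measurable set, the manifold is cut into finitely many measurable pieces, each
  contained in a compact part of a chart domain (the indicator functions of the pieces play the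
  role of a partition of unity with compact supports). On a compact manifold such a decomposition
  exists, and by the change of variables formula the integral does not depend on its choice.\<close>

definition chart_partition ::
    "('m, 'n::finite) chart set \<Rightarrow> ('m, 'n) chart set \<Rightarrow> (('m, 'n) chart \<Rightarrow> 'm set) \<Rightarrow> bool" where
  "chart_partition A C B \<longleftrightarrow>
     finite C \<and> C \<subseteq> A \<and> disjoint_family_on B C \<and> (\<Union>c\<in>C. B c) = (\<Union>c\<in>A. dom_of c) \<and>
     (\<forall>c\<in>C. B c \<subseteq> dom_of c \<and>
        (\<exists>K. compact K \<and> coord c ` B c \<subseteq> K \<and> K \<subseteq> coord c ` dom_of c) \<and>
        (\<forall>d\<in>A. coord d ` (B c \<inter> dom_of d) \<in> sets lebesgue))"

definition form_integral ::
    "('m, 'n::finite) chart set \<Rightarrow> (('m, 'n) chart \<Rightarrow> 'm \<Rightarrow> real) \<Rightarrow> 'm set \<Rightarrow> real" where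
  "form_integral A \<omega> Y =
     (let (C, B) = (SOME (C, B). chart_partition A C B)
      in \<Sum>c\<in>C. LINT x : coord c ` (Y \<inter> B c) | lebesgue. \<omega> c (coord_inv c x))"

definition volume_form :: "('m, 'n::finite) components \<Rightarrow> ('m, 'n) chart \<Rightarrow> 'm \<Rightarrow> real" where
  "volume_form g = (\<lambda>c p. sqrt (det (g c p)))"

definition Vol :: "('m, 'n::finite) chart set \<Rightarrow> 'm set \<Rightarrow> ('m, 'n) components \<Rightarrow> real" where
  "Vol A Y g = form_integral A (volume_form g) Y"


section \<open>The \<open>L\<^sup>2\<close> metric and its distance function\<close>

definition L2_inner ::
    "('m, 'n::finite) chart set \<Rightarrow> ('m, 'n) components \<Rightarrow> ('m, 'n) components \<Rightarrow> ('m, 'n) components \<Rightarrow> real" where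
  "L2_inner A g h k = form_integral A
     (\<lambda>c p. trace (matrix_inv (g c p) ** h c p ** matrix_inv (g c p) ** k c p) * volume_form g c p)
     (\<Union>c\<in>A. dom_of c)"

text \<open>Convergence in the Frechet space of smooth symmetric tensor fields: locally uniform
  convergence, in every chart, of the components and all their partial derivatives.\<close>

definition tensor_tendsto ::
    "('m, 'n::finite) chart set \<Rightarrow> ('a \<Rightarrow> ('m, 'n) components) \<Rightarrow> ('m, 'n) components \<Rightarrow> 'a filter \<Rightarrow> bool" where
  "tensor_tendsto A f l F \<longleftrightarrow>
     (\<forall>c\<in>A. \<forall>K is. compact K \<and> K \<subseteq> coord c ` dom_of c \<longrightarrow>
        uniform_limit K (\<lambda>s. iter_partial is (\<lambda>x. f s c (coord_inv c x)))
          (iter_partial is (\<lambda>x. l c (coord_inv c x))) F)"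

definition tensor_has_derivative ::
    "('m, 'n::finite) chart set \<Rightarrow> (real \<Rightarrow> ('m, 'n) components) \<Rightarrow> ('m, 'n) components \<Rightarrow> real \<Rightarrow> real set \<Rightarrow> bool" where
  "tensor_has_derivative A \<gamma> h t T \<longleftrightarrow>
     h \<in> sym_tensors A \<and>
     tensor_tendsto A (\<lambda>s c p. (\<gamma> s c p - \<gamma> t c p) /\<^sub>R (s - t)) h (at t within T)"

definition tensor_C1_on ::
    "('m, 'n::finite) chart set \<Rightarrow> real set \<Rightarrow> (real \<Rightarrow> ('m, 'n) components) \<Rightarrow> bool" where
  "tensor_C1_on A T \<gamma> \<longleftrightarrow>
     (\<exists>\<gamma>'. \<forall>t\<in>T. tensor_has_derivative A \<gamma> (\<gamma>' t) t T \<and> tensor_tendsto A \<gamma>' (\<gamma>' t) (at t within T))"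

text \<open>Continuity at the break points follows, since \<open>\<gamma>\<close> is \<open>C\<^sup>1\<close> on each closed subinterval.\<close>

definition metric_paths ::
    "('m, 'n::finite) chart set \<Rightarrow> ('m, 'n) components \<Rightarrow> ('m, 'n) components \<Rightarrow> (real \<Rightarrow> ('m, 'n) components) set" where
  "metric_paths A g0 g1 = {\<gamma>.
     \<gamma> 0 = g0 \<and> \<gamma> 1 = g1 \<and> (\<forall>t\<in>{0..1}. \<gamma> t \<in> riem_metrics A) \<and>
     (\<exists>N \<tau>. \<tau> 0 = 0 \<and> \<tau> N = 1 \<and>
        (\<forall>i<N. \<tau> i < \<tau> (Suc i) \<and> tensor_C1_on A {\<tau> i..\<tau> (Suc i)} \<gamma>))}"

text \<open>Unspecified at the finitely many break points, which do not affect the length.\<close>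

definition tensor_velocity ::
    "('m, 'n::finite) chart set \<Rightarrow> (real \<Rightarrow> ('m, 'n) components) \<Rightarrow> real \<Rightarrow> ('m, 'n) components" where
  "tensor_velocity A \<gamma> t = (THE h. tensor_has_derivative A \<gamma> h t {0..1})"

definition L2_length :: "('m, 'n::finite) chart set \<Rightarrow> (real \<Rightarrow> ('m, 'n) components) \<Rightarrow> real" where
  "L2_length A \<gamma> =
     integral {0..1} (\<lambda>t. sqrt (L2_inner A (\<gamma> t) (tensor_velocity A \<gamma> t) (tensor_velocity A \<gamma> t)))"

definition L2_dist ::
    "('m, 'n::finite) chart set \<Rightarrow> ('m, 'n) components \<Rightarrow> ('m, 'n) components \<Rightarrow> real" where
  "L2_dist A g0 g1 = Inf (L2_length A ` metric_paths A g0 g1)"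

end

theory Submission
  imports Defs
begin

text \<open>Along a path of metrics with velocity \<open>h\<close>, the volume form satisfies
  \<open>\<mu>' = 1/2 tr(g\<^sup>-\<^sup>1h) \<mu>\<close>, and \<open>(tr k)\<^sup>2 \<le> n tr(k\<^sup>2)\<close> holds for \<open>k = g\<^sup>-\<^sup>1h\<close> because \<open>k\<close> is
  self-adjoint for \<open>g\<close>. By Cauchy-Schwarz, \<open>|Vol(Y)'| \<le> 1/2 sqrt (n Vol(Y)) \<parallel>h\<parallel>\<close>, so
  \<open>sqrt (Vol(Y))\<close> changes at most at the rate \<open>sqrt n / 4 \<parallel>h\<parallel>\<close>; integrate over the path and take
  the infimum. Cauchy-Schwarz is applied in the pointwise form
  \<open>2 |u| \<le> r u\<^sup>2 + 1 / r\<close> for all \<open>r > 0\<close>, which passes through the sum over the charts.\<close>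

section \<open>Positive definite matrices\<close>

text \<open>The constant is sqrt n * 1/2 * 1/2: one half comes from the root in sqrt(det g), one
  half from differentiating sqrt(Vol), and sqrt n from the trace inequality. The energy lives on all
  of M while the volume sees only Y; since the energy density is nonnegative, its integral may be
  enlarged from Y to M after the pointwise estimate. What shapes the proof is that integrals are
  sums over a chart partition picked by \<open>SOME\<close>. Once a partition is known to exist, the
  same finitely many pieces serve every form and every set, so volume and energy are compared piece
  by piece. Each piece lies in a compact subset of a chart image, where convergence of tensor fields
  is uniform; this gives joint continuity in time and space, hence dominated differentiation under
  the integral. Since \<open>L2_dist\<close> is an infimum of reals, some path must also be
  exhibited: the segment between the two metrics is one.\<close>

lemma trace_matrix_mult:
  fixes P Q :: "real^'n^'n"
  shows "trace (P ** Q) = (\<Sum>i\<in>UNIV. \<Sum>j\<in>UNIV. P$i$j * Q$j$i)"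
  by (simp add: trace_def matrix_matrix_mult_def)

lemma inner_matrix_vector:
  fixes Q :: "real^'n^'n"
  shows "w \<bullet> (Q *v w) = (\<Sum>i\<in>UNIV. \<Sum>j\<in>UNIV. w$i * Q$i$j * w$j)"
  by (simp add: inner_vec_def matrix_vector_mult_def sum_distrib_left mult.assoc)

lemma sym_inner_swap:
  fixes P :: "real^'n^'n"
  assumes "transpose P = P"
  shows "(P *v u) \<bullet> v = u \<bullet> (P *v v)"
  using assms by (metis dot_lmul_matrix matrix_transpose_mul transpose_matrix_vector)

text \<open>Induction on a set of indices supporting \<open>P\<close>: subtracting the rank-one matrix
  \<open>w w\<^sup>T / P\<^sub>k\<^sub>k\<close>, with \<open>w\<close> the \<open>k\<close>-th column of \<open>P\<close>, removes \<open>k\<close> from the support.\<close>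

lemma trace_mult_psd_nonneg:
  fixes P Q :: "real^'n^'n"
  assumes P: "transpose P = P" "\<And>v. 0 \<le> v \<bullet> (P *v v)"
    and Q: "\<And>v. 0 \<le> v \<bullet> (Q *v v)"
  shows "0 \<le> trace (P ** Q)"
proof -
  have "0 \<le> trace (P ** Q)"
    if "finite I" "transpose P = P" "\<And>v. 0 \<le> v \<bullet> (P *v v)"
      "\<And>i j. i \<notin> I \<or> j \<notin> I \<Longrightarrow> P$i$j = 0" for I and P :: "real^'n^'n"
    using that
  proof (induction I arbitrary: P rule: finite_induct)
    case empty
    then show ?case by (simp add: trace_matrix_mult)
  next
    case (insert k I)
    have sym: "P$i$j = P$j$i" for i j
      using arg_cong[OF insert.prems(1), of "\<lambda>M. M$j$i"] by (simp add: transpose_def)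
    define w where "w = P *v axis k 1"
    have w: "w $ i = P$i$k" for i
      by (simp add: w_def matrix_vector_mult_basis column_def)
    have Pkk: "axis k 1 \<bullet> (P *v axis k 1) = P$k$k"
      using w[of k] by (simp add: inner_axis' w_def)
    then have Pkk0: "P$k$k \<ge> 0"
      using insert.prems(2)[of "axis k 1"] by simp
    \<comment> \<open>If the diagonal entry vanishes, the form at
      \<open>u + s *\<^sub>R axis k 1\<close> is affine in \<open>s\<close> with slope twice
      \<open>u \<bullet> w\<close>; a nonzero slope would let it reach -1, which is what the chosen
      \<open>s\<close> does.\<close>
    have wz: "w = 0" if z: "P$k$k = 0"
    proof -
      have "u \<bullet> w = 0" for u
      proof (rule ccontr)
        assume ne: "u \<bullet> w \<noteq> 0"
        define s where "s = - (u \<bullet> (P *v u) + 1) / (2 * (u \<bullet> w))"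
        have "0 \<le> (u + s *\<^sub>R axis k 1) \<bullet> (P *v (u + s *\<^sub>R axis k 1))"
          by (rule insert.prems)
        also have "\<dots> = u \<bullet> (P *v u) + s * (u \<bullet> w) + s * (axis k 1 \<bullet> (P *v u))
             + s * s * P$k$k"
          using Pkk by (simp add: matrix_vector_right_distrib matrix_vector_mult_scaleR
              inner_add_left inner_add_right w_def algebra_simps)
        also have "axis k 1 \<bullet> (P *v u) = u \<bullet> w"
          using sym_inner_swap[OF insert.prems(1), of "axis k 1" u]
          by (simp add: w_def inner_commute)
        also have "u \<bullet> (P *v u) + s * (u \<bullet> w) + s * (u \<bullet> w) + s * s * P$k$k = -1"
          using z ne by (simp add: s_def field_simps)
        finally show False by simp
      qed
      then show ?thesis by (metis inner_eq_zero_iff)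
    qed
    \<comment> \<open>This is a Schur complement. If \<open>P$k$k\<close> is 0, division by zero
      yields 0, so \<open>R\<close> is \<open>P\<close> itself.\<close>
    define R :: "real^'n^'n" where "R = (\<chi> i j. P$i$j - w$i * w$j / P$k$k)"
    have quad_R: "v \<bullet> (R *v v) = v \<bullet> (P *v v) - (w \<bullet> v)\<^sup>2 / P$k$k" for v
      unfolding inner_matrix_vector R_def
      by (simp add: inner_vec_def algebra_simps sum_subtractf power2_eq_square sum_product
          sum_divide_distrib)
    have "0 \<le> trace (R ** Q)"
    proof (rule insert.IH)
      show "transpose R = R"
        using sym by (simp add: R_def transpose_def vec_eq_iff mult.commute)
      show "0 \<le> v \<bullet> (R *v v)" for v
      proof (cases "P$k$k = 0")
        case True
        then show ?thesis using insert.prems(2)[of v] by (simp add: quad_R)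
      next
        case False
        \<comment> \<open>This \<open>s\<close> minimises the form of \<open>P\<close> along the
          line through \<open>v\<close> in direction \<open>axis k 1\<close>; the minimum is the
          form of \<open>R\<close> at \<open>v\<close>.\<close>
        define s where "s = - (w \<bullet> v) / P$k$k"
        have "0 \<le> (v + s *\<^sub>R axis k 1) \<bullet> (P *v (v + s *\<^sub>R axis k 1))"
          by (rule insert.prems)
        also have "\<dots> = v \<bullet> (P *v v) + s * (v \<bullet> w) + s * (axis k 1 \<bullet> (P *v v))
             + s * s * P$k$k"
          using Pkk by (simp add: matrix_vector_right_distrib matrix_vector_mult_scaleR
              inner_add_left inner_add_right w_def algebra_simps)
        also have "axis k 1 \<bullet> (P *v v) = v \<bullet> w"
          using sym_inner_swap[OF insert.prems(1), of "axis k 1" v]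
          by (simp add: w_def inner_commute)
        also have "v \<bullet> (P *v v) + s * (v \<bullet> w) + s * (v \<bullet> w) + s * s * P$k$k = v \<bullet> (R *v v)"
          using False by (simp add: quad_R s_def field_simps power2_eq_square inner_commute)
        finally show ?thesis .
      qed
      \<comment> \<open>Row and column \<open>k\<close> cancel when \<open>P$k$k\<close> is nonzero;
        otherwise the whole column \<open>w\<close> of \<open>P\<close> is already 0.\<close>
      show "R$i$j = 0" if "i \<notin> I \<or> j \<notin> I" for i j
      proof (cases "i \<in> insert k I \<and> j \<in> insert k I")
        case True
        then have "i = k \<or> j = k" using that by blast
        moreover have "P$k$k = 0 \<Longrightarrow> P$m$k = 0" for m
          using w wz by (metis zero_index)
        ultimately show ?thesis
          using sym w by (cases "P$k$k = 0") (auto simp: R_def)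
      next
        case False
        then show ?thesis
          using insert.prems(3)[of i j] insert.prems(3)[of i k] insert.prems(3)[of j k] w
          by (auto simp: R_def)
      qed
    qed
    moreover have "trace (P ** Q) = trace (R ** Q) + w \<bullet> (Q *v w) / P$k$k"
    proof -
      have "w \<bullet> (Q *v w) = (\<Sum>i\<in>UNIV. \<Sum>j\<in>UNIV. w$i * w$j * Q$j$i)"
        unfolding inner_matrix_vector by (subst sum.swap) (simp add: mult_ac)
      then show ?thesis
        by (simp add: trace_matrix_mult R_def algebra_simps sum_subtractf sum_divide_distrib)
    qed
    ultimately show ?case using Q[of w] Pkk0 by simp
  qed
  from this[of UNIV P] P show ?thesis by simp
qed

lemma pos_def_invertible:
  fixes g :: "real^'n^'n"
  assumes "\<And>v. v \<noteq> 0 \<Longrightarrow> 0 < v \<bullet> (g *v v)"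
  shows "invertible g"
proof -
  have "g *v v = 0 \<Longrightarrow> v = 0" for v
    using assms[of v] by auto
  then show ?thesis
    by (simp add: invertible_left_inverse matrix_left_invertible_ker)
qed

text \<open>The segment from the identity to \<open>g\<close> consists of positive definite, hence
  invertible, matrices. The determinant starts at 1 and never vanishes along it, so it cannot change
  sign.\<close>

lemma pos_def_det_pos:
  fixes g :: "real^'n^'n"
  assumes pd: "\<And>v. v \<noteq> 0 \<Longrightarrow> 0 < v \<bullet> (g *v v)"
  shows "0 < det g"
proof (rule ccontr)
  assume n: "\<not> 0 < det g"
  define f where "f s = det ((1 - s) *\<^sub>R mat 1 + s *\<^sub>R g)" for s :: real
  have nz: "f s \<noteq> 0" if s: "0 \<le> s" "s \<le> 1" for s
  proof -
    have "0 < v \<bullet> (((1 - s) *\<^sub>R mat 1 + s *\<^sub>R g) *v v)" if "v \<noteq> 0" for v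
    proof -
      have "v \<bullet> (((1 - s) *\<^sub>R mat 1 + s *\<^sub>R g) *v v) = (1 - s) * (v \<bullet> v) + s * (v \<bullet> (g *v v))"
        by (simp add: matrix_vector_mult_add_rdistrib inner_add_right flip: scaleR_matrix_vector_assoc)
      moreover have "0 < v \<bullet> v" "0 < v \<bullet> (g *v v)" using that pd by auto
      ultimately show ?thesis using s
        by (cases "s = 0") (auto intro!: add_nonneg_pos)
    qed
    then show ?thesis
      unfolding f_def using pos_def_invertible invertible_det_nz by blast
  qed
  have "continuous_on {0..1} f"
    unfolding f_def det_def by (intro continuous_intros) 
  moreover have "f 0 = 1" "f 1 \<le> 0" using n by (auto simp: f_def)
  ultimately obtain s where "0 \<le> s" "s \<le> 1" "f s = 0"
    using IVT2'[of f 1 0 0] by auto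
  then show False using nz by blast
qed

lemma matrix_inv_right_left:
  fixes g :: "real^'n^'n"
  assumes "invertible g"
  shows "g ** matrix_inv g = mat 1" "matrix_inv g ** g = mat 1"
  using assms unfolding invertible_def matrix_inv_def by (metis (mono_tags, lifting) someI_ex)+

lemma matrix_mult_scaleR:
  fixes M :: "real^'m^'n" and N :: "real^'k^'m"
  shows "(c *\<^sub>R M) ** N = c *\<^sub>R (M ** N)" "M ** (c *\<^sub>R N) = c *\<^sub>R (M ** N)"
  by (simp_all add: matrix_matrix_mult_def vec_eq_iff sum_distrib_left mult_ac)

lemma matrix_mult_add_left:
  fixes M M' :: "real^'m^'n" and N :: "real^'k^'m"
  shows "(M + M') ** N = M ** N + M' ** N"
  by (simp add: matrix_matrix_mult_def vec_eq_iff algebra_simps sum.distrib)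

lemma matrix_mult_diff:
  fixes M M' :: "real^'m^'n" and N N' :: "real^'k^'m"
  shows "(M - M') ** N = M ** N - M' ** N" "M ** (N - N') = M ** N - M ** N'"
  by (simp_all add: matrix_matrix_mult_def vec_eq_iff algebra_simps sum_subtractf)

text \<open>With \<open>t = tr(g\<^sup>-\<^sup>1h)\<close>, apply positivity of \<open>k \<mapsto> tr(g\<^sup>-\<^sup>1k g\<^sup>-\<^sup>1k)\<close> to the traceless part
  \<open>k = h - (t/n) g\<close>.\<close>

lemma trace_square_le:
  fixes g h :: "real^'n^'n"
  assumes g: "transpose g = g" "\<And>v. v \<noteq> 0 \<Longrightarrow> 0 < v \<bullet> (g *v v)"
    and h: "transpose h = h"
  shows "(trace (matrix_inv g ** h))\<^sup>2
    \<le> real CARD('n) * trace (matrix_inv g ** h ** matrix_inv g ** h)"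
proof -
  define P where "P = matrix_inv g"
  have inv: "g ** P = mat 1" "P ** g = mat 1"
    unfolding P_def using pos_def_invertible[OF g(2)] by (auto intro: matrix_inv_right_left)
  have Psym: "transpose P = P"
    using inv by (metis g(1) matrix_mul_assoc matrix_mul_lid matrix_mul_rid matrix_transpose_mul transpose_mat)
  \<comment> \<open>Writing \<open>v\<close> as \<open>g *v (P *v v)\<close> turns the form of the
    inverse at \<open>v\<close> into the form of \<open>g\<close> at \<open>P *v v\<close>.\<close>
  have Ppsd: "0 \<le> v \<bullet> (P *v v)" for v
  proof -
    have "g *v (P *v v) = v"
      by (simp add: matrix_vector_mul_assoc inv)
    then have "v \<bullet> (P *v v) = (P *v v) \<bullet> (g *v (P *v v))"
      by (simp add: inner_commute)
    then show ?thesis using g(2)[of "P *v v"] by (cases "P *v v = 0") auto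
  qed
  define N where "N = real CARD('n)"
  have N: "N > 0" by (simp add: N_def)
  define t where "t = trace (P ** h)"
  define k where "k = h - (t / N) *\<^sub>R g"
  have ksym: "transpose k = k"
    using h g(1) by (simp add: k_def transpose_def vec_eq_iff)
  \<comment> \<open>The trace of the square of \<open>P ** k\<close> is regrouped as that of a
    product of two positive semidefinite matrices, \<open>P\<close> and
    \<open>k ** P ** k\<close>.\<close>
  have "0 \<le> v \<bullet> ((k ** P ** k) *v v)" for v
  proof -
    have "v \<bullet> ((k ** P ** k) *v v) = v \<bullet> (k *v (P *v (k *v v)))"
      by (simp add: matrix_vector_mul_assoc matrix_mul_assoc)
    also have "\<dots> = (k *v v) \<bullet> (P *v (k *v v))"
      using sym_inner_swap[OF ksym] by metis
    finally show ?thesis using Ppsd by simp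
  qed
  then have "0 \<le> trace (P ** (k ** P ** k))"
    by (rule trace_mult_psd_nonneg[OF Psym Ppsd])
  also have "P ** (k ** P ** k) = (P ** k) ** (P ** k)"
    by (simp add: matrix_mul_assoc)
  also have "P ** k = P ** h - (t / N) *\<^sub>R mat 1"
    by (simp add: k_def matrix_mult_diff matrix_mult_scaleR inv)
  also have "trace ((P ** h - (t / N) *\<^sub>R mat 1) ** (P ** h - (t / N) *\<^sub>R mat 1))
     = trace (P ** h ** (P ** h)) - t\<^sup>2 / N"
  proof -
    have sc: "trace (c *\<^sub>R M) = c * trace M" for c and M :: "real^'n^'n"
      by (simp add: trace_def sum_distrib_left)
    define M where "M = P ** h"
    have t: "trace M = t" by (simp add: M_def t_def)
    \<comment> \<open>Taking traces gives tr(M M) - 2ct + c*c*n, which is smallest for c = t/n; this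
      is the source of the factor t/n in \<open>k\<close>.\<close>
    have expand: "(M - c *\<^sub>R mat 1) ** (M - c *\<^sub>R mat 1) = M ** M - (2 * c) *\<^sub>R M + (c * c) *\<^sub>R mat 1" for c
      by (simp add: matrix_mult_diff matrix_mult_scaleR algebra_simps
        flip: scaleR_2)
    then show ?thesis
      unfolding M_def[symmetric] expand
      using N by (simp add: trace_add trace_sub sc trace_I t N_def field_simps power2_eq_square)
  qed
  finally have "t\<^sup>2 / N \<le> trace (P ** h ** (P ** h))" by simp
  then show ?thesis
    using N by (simp add: field_simps t_def P_def N_def matrix_mul_assoc)
qed

text \<open>At the identity only the identity permutation contributes to the derivative, since any other
  permutation moves at least two indices.\<close>

lemma has_real_derivative_det_at_mat_1:
  fixes N :: "real \<Rightarrow> real^'n^'n"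
  assumes N: "(N has_vector_derivative N') (at t within T)" and Nt: "N t = mat 1"
  shows "((\<lambda>s. det (N s)) has_real_derivative trace N') (at t within T)"
proof -
  have ent: "((\<lambda>s. N s $ i $ j) has_derivative (\<lambda>y. y * N' $ i $ j)) (at t within T)" for i j
  proof -
    have "((\<lambda>s. N s $ i $ j) has_derivative (\<lambda>y. (y *\<^sub>R N') $ i $ j)) (at t within T)"
      using N unfolding has_vector_derivative_def
      by (intro bounded_linear.has_derivative[OF bounded_linear_vec_nth])
    then show ?thesis by simp
  qed
  let ?S = "{p. p permutes (UNIV::'n set)}"
  have "((\<lambda>s. \<Sum>p\<in>?S. of_int (sign p) * (\<Prod>i\<in>UNIV. N s $ i $ p i)) has_derivative
     (\<lambda>y. \<Sum>p\<in>?S. of_int (sign p) *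
        (\<Sum>i\<in>UNIV. (y * N' $ i $ p i) * (\<Prod>j\<in>UNIV - {i}. N t $ j $ p j)))) (at t within T)"
    by (intro has_derivative_sum has_derivative_mult_right has_derivative_prod ent)
  moreover have "(\<Sum>p\<in>?S. of_int (sign p) *
        (\<Sum>i\<in>UNIV. (y * N' $ i $ p i) * (\<Prod>j\<in>UNIV - {i}. N t $ j $ p j))) = trace N' * y" for y
  proof -
    have z: "(\<Prod>j\<in>UNIV - {i}. N t $ j $ p j) = 0" if p: "p permutes UNIV" "p \<noteq> id" for p and i :: 'n
    proof -
      obtain a where a: "p a \<noteq> a" using p(2) by (auto simp: fun_eq_iff)
      have "p (p a) \<noteq> p a" using a permutes_inj[OF p(1)] by (auto dest: injD)
      with a obtain j where "j \<noteq> i" "p j \<noteq> j" by metis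
      then have "N t $ j $ p j = 0" by (simp add: Nt mat_def)
      then show ?thesis using \<open>j \<noteq> i\<close> by (intro prod_zero) auto
    qed
    have "(\<Sum>p\<in>?S. of_int (sign p) *
        (\<Sum>i\<in>UNIV. (y * N' $ i $ p i) * (\<Prod>j\<in>UNIV - {i}. N t $ j $ p j)))
       = (\<Sum>p\<in>{id}. of_int (sign p) *
        (\<Sum>i\<in>UNIV. (y * N' $ i $ p i) * (\<Prod>j\<in>UNIV - {i}. N t $ j $ p j)))"
      by (rule sum.mono_neutral_right) (auto simp: permutes_id z finite_permutations)
    also have "\<dots> = (\<Sum>i\<in>UNIV. y * N' $ i $ i)"
      by (simp add: Nt mat_def sign_id)
    also have "\<dots> = trace N' * y"
      by (simp add: trace_def mult.commute flip: sum_distrib_left)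
    finally show ?thesis .
  qed
  ultimately show ?thesis
    by (simp add: det_def has_field_derivative_def)
qed

text \<open>Jacobi's formula, reduced to a curve through the identity: with the fixed matrix
  \<open>P\<close> inverse to \<open>G t\<close>, the curve \<open>P ** G s\<close> equals
  \<open>mat 1\<close> at time \<open>t\<close>, and det(G t) * det(P ** G s) = det(G s).\<close>

lemma has_real_derivative_sqrt_det:
  fixes G :: "real \<Rightarrow> real^'n^'n"
  assumes G: "(G has_vector_derivative G') (at t within T)" and pos: "0 < det (G t)"
  shows "((\<lambda>s. sqrt (det (G s))) has_real_derivative
     trace (matrix_inv (G t) ** G') * sqrt (det (G t)) / 2) (at t within T)"
proof -
  define P where "P = matrix_inv (G t)"
  have inv: "G t ** P = mat 1" "P ** G t = mat 1"
    using pos unfolding P_def by (auto intro!: matrix_inv_right_left simp: invertible_det_nz)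
  have lin: "bounded_linear (\<lambda>M. P ** M)"
    by (intro linear_conv_bounded_linear[THEN iffD1] linearI) (simp_all add: matrix_add_ldistrib matrix_mult_scaleR)
  have "((\<lambda>s. P ** G s) has_vector_derivative P ** G') (at t within T)"
    by (rule bounded_linear.has_vector_derivative[OF lin G])
  then have "((\<lambda>s. det (P ** G s)) has_real_derivative trace (P ** G')) (at t within T)"
    by (rule has_real_derivative_det_at_mat_1) (simp add: inv)
  then have "((\<lambda>s. det (G t) * det (P ** G s)) has_real_derivative det (G t) * trace (P ** G')) (at t within T)"
    by (rule DERIV_cmult)
  moreover have "det (G t) * det (P ** G s) = det (G s)" for s
    by (simp flip: det_mul add: matrix_mul_assoc inv)
  ultimately have "((\<lambda>s. det (G s)) has_real_derivative det (G t) * trace (P ** G')) (at t within T)"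
    by simp
  then have "((\<lambda>s. sqrt (det (G s))) has_real_derivative
      inverse (sqrt (det (G t))) / 2 * (det (G t) * trace (P ** G'))) (at t within T)"
    by (rule DERIV_chain2[where f = sqrt and g = "\<lambda>s. det (G s)" and x = t, OF DERIV_real_sqrt[OF pos]])
  moreover have "inverse (sqrt (det (G t))) / 2 * (det (G t) * trace (P ** G'))
      = trace (P ** G') * sqrt (det (G t)) / 2"
    using pos by (simp add: field_simps flip: real_sqrt_mult)
  ultimately show ?thesis by (simp only: P_def)
qed

section \<open>Continuity of determinant, product, trace and inverse\<close>

lemma continuous_on_det:
  fixes F :: "'a::topological_space \<Rightarrow> real^'n^'n"
  assumes "continuous_on S F"
  shows "continuous_on S (\<lambda>x. det (F x))"
  unfolding det_def by (intro continuous_intros assms)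

lemma continuous_on_matrix_mult:
  fixes F H :: "'a::topological_space \<Rightarrow> real^'n^'n"
  assumes "continuous_on S F" "continuous_on S H"
  shows "continuous_on S (\<lambda>x. F x ** H x)"
  unfolding matrix_matrix_mult_def by (intro continuous_intros assms)

lemma continuous_on_trace:
  fixes F :: "'a::topological_space \<Rightarrow> real^'n^'n"
  assumes "continuous_on S F"
  shows "continuous_on S (\<lambda>x. trace (F x))"
  unfolding trace_def by (intro continuous_intros assms)

text \<open>By Cramer's rule each entry of the inverse is a quotient of two determinants in the
  entries of \<open>F x\<close>.\<close>

lemma continuous_on_matrix_inv:
  fixes F :: "'a::topological_space \<Rightarrow> real^'n^'n"
  assumes F: "continuous_on S F" and nz: "\<And>x. x \<in> S \<Longrightarrow> det (F x) \<noteq> 0"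
  shows "continuous_on S (\<lambda>x. matrix_inv (F x))"
proof -
  define C where "C x = (\<chi> k l. det (\<chi> i j. if j = k then axis l 1 $ i else F x $ i $ j) / det (F x))" for x
  have eq: "matrix_inv (F x) = C x" if "x \<in> S" for x
  proof -
    have "F x *v (matrix_inv (F x) *v axis l 1) = axis l 1" for l
      using nz[OF that] by (simp add: matrix_vector_mul_assoc matrix_inv_right_left invertible_det_nz)
    then have "matrix_inv (F x) *v axis l 1 =
      (\<chi> k. det (\<chi> i j. if j = k then axis l 1 $ i else F x $ i $ j) / det (F x))" for l
      using cramer[OF nz[OF that]] by blast
    then have "matrix_inv (F x) $ k $ l = det (\<chi> i j. if j = k then axis l 1 $ i else F x $ i $ j) / det (F x)" for k l
      by (simp add: matrix_vector_mult_basis column_def vec_eq_iff)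
    then show ?thesis by (simp add: C_def vec_eq_iff)
  qed
  have "continuous_on S (\<lambda>x. if j = k then axis l 1 $ i else F x $ i $ j)" for i j k l
    by (cases "j = k") (auto intro!: continuous_intros F)
  then have "continuous_on S C"
    unfolding C_def by (intro continuous_intros continuous_on_det F) (use nz in auto)
  then show ?thesis using eq by (simp cong: continuous_on_cong)
qed

section \<open>Parameter integrals\<close>

text \<open>The set \<open>S\<close> is only Lebesgue measurable, so integrability is obtained on
  the Borel set \<open>K\<close>, transferred to the completion, and then restricted.\<close>

lemma set_integrable_continuous_compact:
  fixes f :: "'a::euclidean_space \<Rightarrow> real"
  assumes "compact K" "continuous_on K f" "S \<in> sets lebesgue" "S \<subseteq> K"
  shows "set_integrable lebesgue S f"
proof -
  have "integrable lborel (\<lambda>x. indicator K x *\<^sub>R f x)"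
    using assms by (intro borel_integrable_compact)
  then have "set_integrable lebesgue K f"
    unfolding set_integrable_def by (simp add: integrable_completion)
  then show ?thesis using assms by (auto intro: set_integrable_subset)
qed

text \<open>Dominated convergence along sequences tending to \<open>t\<close>; the constant
  \<open>B\<close> is an integrable majorant because \<open>S\<close> lies in the compact set
  \<open>K\<close>.\<close>

lemma tendsto_set_lebesgue_integral:
  fixes f :: "real \<Rightarrow> 'a::euclidean_space \<Rightarrow> real"
  assumes S: "compact K" "S \<in> sets lebesgue" "S \<subseteq> K"
    and f: "\<And>s. s \<in> T - {t} \<Longrightarrow> continuous_on K (f s)" and l: "continuous_on K l"
    and lim: "\<And>x. x \<in> K \<Longrightarrow> ((\<lambda>s. f s x) \<longlongrightarrow> l x) (at t within T)"
    and bd: "\<And>s x. s \<in> T - {t} \<Longrightarrow> x \<in> K \<Longrightarrow> \<bar>f s x\<bar> \<le> B"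
  shows "((\<lambda>s. LINT x:S|lebesgue. f s x) \<longlongrightarrow> (LINT x:S|lebesgue. l x)) (at t within T)"
  unfolding tendsto_at_iff_sequentially
proof (intro allI impI)
  fix X :: "nat \<Rightarrow> real"
  assume X: "\<forall>i. X i \<in> T - {t}" "X \<longlonglongrightarrow> t"
  have meas: "(\<lambda>x. indicator S x *\<^sub>R h x) \<in> borel_measurable lebesgue" if "continuous_on K h" for h :: "'a \<Rightarrow> real"
    using set_integrable_continuous_compact[OF S(1) that S(2,3)]
    unfolding set_integrable_def by (rule borel_measurable_integrable)
  have "(\<lambda>i. LINT x:S|lebesgue. f (X i) x) \<longlonglongrightarrow> (LINT x:S|lebesgue. l x)"
    unfolding set_lebesgue_integral_def
  proof (rule integral_dominated_convergence[where w = "\<lambda>x. indicator S x *\<^sub>R B"])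
    show "integrable lebesgue (\<lambda>x. indicator S x *\<^sub>R B)"
      using set_integrable_continuous_compact[OF S(1) continuous_on_const S(2,3)]
      unfolding set_integrable_def .
    show "AE x in lebesgue. (\<lambda>i. indicator S x *\<^sub>R f (X i) x) \<longlonglongrightarrow> indicator S x *\<^sub>R l x"
    proof (rule AE_I2)
      fix x :: 'a
      show "(\<lambda>i. indicator S x *\<^sub>R f (X i) x) \<longlonglongrightarrow> indicator S x *\<^sub>R l x"
        using lim[of x] X S(3) unfolding tendsto_at_iff_sequentially
        by (cases "x \<in> S") (auto simp: comp_def)
    qed
    show "AE x in lebesgue. norm (indicator S x *\<^sub>R f (X i) x) \<le> indicator S x *\<^sub>R B" for i
      using bd[of "X i"] X(1) S(3) by (intro AE_I2) (auto simp: indicator_def)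
  qed (use X(1) f l meas in auto)
  then show "((\<lambda>s. LINT x:S|lebesgue. f s x) \<circ> X) \<longlonglongrightarrow> (LINT x:S|lebesgue. l x)"
    by (simp add: comp_def)
qed

lemma continuous_on_case_prod_bounded:
  fixes f :: "'a::metric_space \<Rightarrow> 'b::metric_space \<Rightarrow> 'c::real_normed_vector"
  assumes "compact T" "compact K" "continuous_on (T \<times> K) (\<lambda>(t, x). f t x)"
  obtains B where "B \<ge> 0" "\<And>t x. t \<in> T \<Longrightarrow> x \<in> K \<Longrightarrow> norm (f t x) \<le> B"
proof -
  have "bounded ((\<lambda>(t, x). f t x) ` (T \<times> K))"
    using assms by (intro compact_imp_bounded compact_continuous_image compact_Times)
  then obtain B where B: "B > 0" "\<forall>y\<in>(\<lambda>(t, x). f t x) ` (T \<times> K). norm y \<le> B"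
    by (auto simp: bounded_pos)
  then have "norm (f t x) \<le> B" if "t \<in> T" "x \<in> K" for t x
    using that by force
  with B that show ?thesis by (meson less_imp_le)
qed

lemma continuous_on_case_prodD:
  assumes "continuous_on (T \<times> K) (\<lambda>(t, x). f t x)"
  shows "t \<in> T \<Longrightarrow> continuous_on K (f t)" "x \<in> K \<Longrightarrow> continuous_on T (\<lambda>t. f t x)"
proof -
  show "continuous_on K (f t)" if "t \<in> T"
    using continuous_on_compose2[OF assms, of K "\<lambda>x. (t, x)"] that
    by (force intro!: continuous_intros)
  show "continuous_on T (\<lambda>t. f t x)" if "x \<in> K"
    using continuous_on_compose2[OF assms, of T "\<lambda>t. (t, x)"] that
    by (force intro!: continuous_intros)
qed

lemma continuous_on_set_lebesgue_integral:
  fixes f :: "real \<Rightarrow> 'a::euclidean_space \<Rightarrow> real"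
  assumes T: "compact T" and S: "compact K" "S \<in> sets lebesgue" "S \<subseteq> K"
    and f: "continuous_on (T \<times> K) (\<lambda>(t, x). f t x)"
  shows "continuous_on T (\<lambda>t. LINT x:S|lebesgue. f t x)"
proof -
  obtain B where "\<And>t x. t \<in> T \<Longrightarrow> x \<in> K \<Longrightarrow> norm (f t x) \<le> B"
    using continuous_on_case_prod_bounded[OF T S(1) f] by metis
  then show ?thesis
    unfolding continuous_on_def
    by (intro ballI tendsto_set_lebesgue_integral[OF S, where B = B])
      (use continuous_on_case_prodD[OF f] in \<open>auto simp: continuous_on_def\<close>)
qed

text \<open>The derivative \<open>f'\<close> is bounded on the compact product, and by the mean
  value inequality the same bound dominates all difference quotients in time.\<close>

lemma has_real_derivative_set_lebesgue_integral:
  fixes f :: "real \<Rightarrow> 'a::euclidean_space \<Rightarrow> real"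
  assumes t: "t \<in> {a..b}" and S: "compact K" "S \<in> sets lebesgue" "S \<subseteq> K"
    and f: "\<And>s. s \<in> {a..b} \<Longrightarrow> continuous_on K (f s)"
    and f': "continuous_on ({a..b} \<times> K) (\<lambda>(t, x). f' t x)"
    and deriv: "\<And>s x. s \<in> {a..b} \<Longrightarrow> x \<in> K \<Longrightarrow>
      ((\<lambda>s. f s x) has_real_derivative f' s x) (at s within {a..b})"
  shows "((\<lambda>s. LINT x:S|lebesgue. f s x) has_real_derivative (LINT x:S|lebesgue. f' t x))
    (at t within {a..b})"
proof -
  obtain B where B: "B \<ge> 0" "\<And>s x. s \<in> {a..b} \<Longrightarrow> x \<in> K \<Longrightarrow> norm (f' s x) \<le> B"
    using continuous_on_case_prod_bounded[OF compact_Icc S(1) f'] by metis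
  have int: "set_integrable lebesgue S (f s)" if "s \<in> {a..b}" for s
    by (rule set_integrable_continuous_compact[OF S(1) f[OF that] S(2,3)])
  have "((\<lambda>s. LINT x:S|lebesgue. (f s x - f t x) / (s - t)) \<longlongrightarrow> (LINT x:S|lebesgue. f' t x)) (at t within {a..b})"
  proof (rule tendsto_set_lebesgue_integral[OF S, where B = B])
    show "continuous_on K (\<lambda>x. (f s x - f t x) / (s - t))" if "s \<in> {a..b} - {t}" for s
      using that t by (auto intro!: continuous_intros f)
    show "continuous_on K (f' t)"
      using continuous_on_case_prodD(1)[OF f' t] .
    show "((\<lambda>s. (f s x - f t x) / (s - t)) \<longlongrightarrow> f' t x) (at t within {a..b})" if "x \<in> K" for x
      using deriv[OF t that] by (simp add: has_field_derivative_iff)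
    show "\<bar>(f s x - f t x) / (s - t)\<bar> \<le> B" if "s \<in> {a..b} - {t}" "x \<in> K" for s x
    proof -
      have "norm (f s x - f t x) \<le> B * norm (s - t)"
        by (rule field_differentiable_bound[where S = "{a..b}" and f' = "\<lambda>s. f' s x"])
          (use that t B deriv in auto)
      then show ?thesis using that by (simp add: field_simps)
    qed
  qed
  moreover
  have "(LINT x:S|lebesgue. (f s x - f t x) / (s - t))
      = ((LINT x:S|lebesgue. f s x) - (LINT x:S|lebesgue. f t x)) / (s - t)" if "s \<in> {a..b}" for s
    using int[OF that] int[OF t] by (simp add: set_integral_diff)
  then have "\<forall>\<^sub>F s in at t within {a..b}. (LINT x:S|lebesgue. (f s x - f t x) / (s - t))
      = ((LINT x:S|lebesgue. f s x) - (LINT x:S|lebesgue. f t x)) / (s - t)"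
    unfolding eventually_at using zero_less_one by blast
  ultimately show ?thesis
    unfolding has_field_derivative_iff by (rule Lim_transform_eventually)
qed

text \<open>Continuity in \<open>x\<close> at the fixed time \<open>t\<close> costs one half of
  epsilon; moving from \<open>s\<close> to \<open>t\<close> costs the other half, uniformly in the
  space variable.\<close>

lemma continuous_on_case_prod_uniform_limit:
  fixes G :: "'a::metric_space \<Rightarrow> 'b::metric_space \<Rightarrow> 'c::metric_space"
  assumes cont: "\<And>t. t \<in> T \<Longrightarrow> continuous_on K (G t)"
    and lim: "\<And>t. t \<in> T \<Longrightarrow> uniform_limit K G (G t) (at t within T)"
  shows "continuous_on (T \<times> K) (\<lambda>(t, x). G t x)"
  unfolding continuous_on_iff
proof (intro ballI allI impI)
  fix p and e :: real
  assume "p \<in> T \<times> K" and e: "e > 0"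
  then obtain t x where p: "p = (t, x)" and tx: "t \<in> T" "x \<in> K" by auto
  obtain d1 where d1: "d1 > 0"
    "\<And>s y. s \<in> T \<Longrightarrow> s \<noteq> t \<Longrightarrow> dist s t < d1 \<Longrightarrow> y \<in> K \<Longrightarrow> dist (G s y) (G t y) < e / 2"
    using lim[OF tx(1)] half_gt_zero[OF e] unfolding uniform_limit_iff eventually_at by metis
  obtain d2 where d2: "d2 > 0" "\<And>y. y \<in> K \<Longrightarrow> dist y x < d2 \<Longrightarrow> dist (G t y) (G t x) < e / 2"
    using cont[OF tx(1)] tx(2) half_gt_zero[OF e] unfolding continuous_on_iff by metis
  have "dist (G s y) (G t x) < e" if "s \<in> T" "y \<in> K" and d: "dist (s, y) (t, x) < min d1 d2" for s y
  proof -
    have "dist s t < d1" "dist y x < d2"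
      using d dist_fst_le[of "(s, y)" "(t, x)"] dist_snd_le[of "(s, y)" "(t, x)"] by auto
    then have "dist (G s y) (G t y) < e / 2"
      using d1(2)[of s y] that e by (cases "s = t") auto
    moreover have "dist (G t y) (G t x) < e / 2"
      using d2(2)[of y] that \<open>dist y x < d2\<close> by auto
    ultimately show ?thesis
      using dist_triangle[of "G s y" "G t x" "G t y"] by simp
  qed
  then show "\<exists>d>0. \<forall>q\<in>T \<times> K. dist q p < d \<longrightarrow>
      dist (case q of (t, x) \<Rightarrow> G t x) (case p of (t, x) \<Rightarrow> G t x) < e"
    using d1(1) d2(1) p by (intro exI[of _ "min d1 d2"]) auto
qed

lemma has_vector_derivative_if_quotient_limit:
  fixes f :: "real \<Rightarrow> 'a::real_normed_vector"
  assumes "((\<lambda>s. (f s - f t) /\<^sub>R (s - t)) \<longlongrightarrow> D) (at t within T)"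
  shows "(f has_vector_derivative D) (at t within T)"
proof -
  have "((\<lambda>s. norm ((f s - f t) /\<^sub>R (s - t) - D)) \<longlongrightarrow> 0) (at t within T)"
    using assms by (simp add: LIM_zero_iff tendsto_norm_zero_iff)
  moreover have "norm ((f s - f t) /\<^sub>R (s - t) - D)
      = norm ((1 / norm (s - t)) *\<^sub>R (f s - (f t + (s - t) *\<^sub>R D)))" if "s \<noteq> t" for s
  proof -
    have "f s - (f t + (s - t) *\<^sub>R D) = (s - t) *\<^sub>R ((f s - f t) /\<^sub>R (s - t) - D)"
      using that by (simp add: scaleR_right_diff_distrib)
    then show ?thesis using that by simp
  qed
  then have "\<forall>\<^sub>F s in at t within T. norm ((f s - f t) /\<^sub>R (s - t) - D)
      = norm ((1 / norm (s - t)) *\<^sub>R (f s - (f t + (s - t) *\<^sub>R D)))"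
    by (simp add: eventually_at_filter)
  ultimately have "((\<lambda>s. norm ((1 / norm (s - t)) *\<^sub>R (f s - (f t + (s - t) *\<^sub>R D)))) \<longlongrightarrow> 0)
      (at t within T)"
    by (rule Lim_transform_eventually)
  from tendsto_norm_zero_cancel[OF this] show ?thesis
    unfolding has_vector_derivative_def has_derivative_within
    by (intro conjI bounded_linear_scaleR_left)
qed

text \<open>This extracts from convergence of tensor fields what differentiation under the integral
  requires. Continuity of \<open>G\<close> in time comes from the derivative: \<open>H\<close> is
  bounded on the compact product, so \<open>G\<close> is Lipschitz in time with one constant for all
  of \<open>K\<close>.\<close>

lemma uniform_quotient_limit:
  fixes G :: "real \<Rightarrow> 'b::metric_space \<Rightarrow> 'c::real_normed_vector"
  assumes K: "compact K"
    and G: "\<And>t. t \<in> {a..b} \<Longrightarrow> continuous_on K (G t)"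
    and H: "\<And>t. t \<in> {a..b} \<Longrightarrow> continuous_on K (H t)"
    and Glim: "\<And>t. t \<in> {a..b} \<Longrightarrow>
      uniform_limit K (\<lambda>s x. (G s x - G t x) /\<^sub>R (s - t)) (H t) (at t within {a..b})"
    and Hlim: "\<And>t. t \<in> {a..b} \<Longrightarrow> uniform_limit K H (H t) (at t within {a..b})"
  shows "continuous_on ({a..b} \<times> K) (\<lambda>(t, x). G t x)"
    and "continuous_on ({a..b} \<times> K) (\<lambda>(t, x). H t x)"
    and "\<And>t x. t \<in> {a..b} \<Longrightarrow> x \<in> K \<Longrightarrow> ((\<lambda>s. G s x) has_vector_derivative H t x) (at t within {a..b})"
proof -
  show contH: "continuous_on ({a..b} \<times> K) (\<lambda>(t, x). H t x)"
    using H Hlim by (rule continuous_on_case_prod_uniform_limit)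
  show deriv: "((\<lambda>s. G s x) has_vector_derivative H t x) (at t within {a..b})"
    if "t \<in> {a..b}" "x \<in> K" for t x
    using tendsto_uniform_limitI[OF Glim[OF that(1)] that(2)]
    by (rule has_vector_derivative_if_quotient_limit)
  obtain B where B: "B \<ge> 0" "\<And>s x. s \<in> {a..b} \<Longrightarrow> x \<in> K \<Longrightarrow> norm (H s x) \<le> B"
    using continuous_on_case_prod_bounded[OF compact_Icc K contH] by metis
  have lip: "norm (G s x - G t x) \<le> B * norm (s - t)"
    if "s \<in> {a..b}" "t \<in> {a..b}" "x \<in> K" for s t x
  proof (rule differentiable_bound[where S = "{a..b}" and f' = "\<lambda>s y. y *\<^sub>R H s x"])
    show "((\<lambda>s. G s x) has_derivative (\<lambda>y. y *\<^sub>R H r x)) (at r within {a..b})" if "r \<in> {a..b}" for r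
      using deriv[OF that \<open>x \<in> K\<close>] by (simp add: has_vector_derivative_def)
    show "onorm (\<lambda>y. y *\<^sub>R H r x) \<le> B" if "r \<in> {a..b}" for r
      using B(1) B(2)[OF that \<open>x \<in> K\<close>]
      by (intro onorm_bound) (auto simp: mult.commute[of B] intro: mult_left_mono)
  qed (use that in auto)
  show "continuous_on ({a..b} \<times> K) (\<lambda>(t, x). G t x)"
  proof (rule continuous_on_case_prod_uniform_limit[OF G])
    fix t assume t: "t \<in> {a..b}"
    show "uniform_limit K G (G t) (at t within {a..b})"
      unfolding uniform_limit_iff
    proof (intro allI impI)
      fix e :: real assume e: "e > 0"
      \<comment> \<open>Dividing by \<open>B + 1\<close> covers the case
        \<open>B = 0\<close>.\<close>
      have "dist (G s x) (G t x) < e"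
        if "s \<in> {a..b}" "dist s t < e / (B + 1)" "x \<in> K" for s x
      proof -
        have "norm (G s x - G t x) \<le> B * norm (s - t)"
          using lip that t by blast
        also have "\<dots> \<le> (B + 1) * norm (s - t)" by (simp add: mult_right_mono)
        also have "\<dots> < e" using that(2) B(1) by (simp add: dist_norm field_simps)
        finally show ?thesis by (simp add: dist_norm)
      qed
      moreover have "e / (B + 1) > 0" using e B(1) by simp
      ultimately show "\<forall>\<^sub>F s in at t within {a..b}. \<forall>x\<in>K. dist (G s x) (G t x) < e"
        unfolding eventually_at by blast
    qed
  qed
qed

text \<open>For positive \<open>a\<close> and \<open>b\<close> the right side is minimal at r =
  sqrt(b/a), with value 2 sqrt(ab). If one of them is 0, the infimum over \<open>r\<close> is 0 but
  need not be attained, so \<open>r\<close> is chosen to push the bound just below a supposedly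
  positive \<open>x\<close>.\<close>

lemma le_sqrt_if_le_all_scalings:
  fixes a b x :: real
  assumes "a \<ge> 0" "b \<ge> 0" and x: "\<And>r. r > 0 \<Longrightarrow> x \<le> r * a + b / r"
  shows "x \<le> 2 * sqrt (a * b)"
proof (rule ccontr)
  assume "\<not> ?thesis"
  then have gt: "x > 2 * sqrt (a * b)" by simp
  moreover have "sqrt (a * b) \<ge> 0" using assms by simp
  ultimately have "x > 0" by linarith
  consider "a = 0" | "b = 0" | "a > 0" "b > 0" using assms by linarith
  then show False
  proof cases
    case 1
    have "b / ((b + 1) / x) < x" using \<open>x > 0\<close> assms(2) by (simp add: field_simps)
    then show ?thesis
      using x[of "(b + 1) / x"] 1 \<open>x > 0\<close> assms(2) by simp
  next
    case 2
    have "x / (a + 1) * a < x" using \<open>x > 0\<close> assms(1) by (simp add: field_simps)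
    then show ?thesis
      using x[of "x / (a + 1)"] 2 \<open>x > 0\<close> assms(1) by simp
  next
    case 3
    have "sqrt (b / a) * a = sqrt (a * b)" "b / sqrt (b / a) = sqrt (a * b)"
      using 3 by (simp_all add: real_sqrt_divide real_sqrt_mult field_simps)
    then show ?thesis using x[of "sqrt (b / a)"] 3 gt by simp
  qed
qed

text \<open>\<open>sqrt (V + \<epsilon>)\<close> with \<open>\<epsilon> \<rightarrow> 0\<close> avoids the singularity of the square root where \<open>V\<close> vanishes.\<close>

lemma sqrt_diff_le_integral:
  fixes V V' E :: "real \<Rightarrow> real"
  assumes ab: "a \<le> b"
    and V: "\<And>t. t \<in> {a..b} \<Longrightarrow> 0 \<le> V t"
    and E: "\<And>t. t \<in> {a..b} \<Longrightarrow> 0 \<le> E t" "continuous_on {a..b} E"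
    and deriv: "\<And>t. t \<in> {a..b} \<Longrightarrow> (V has_real_derivative V' t) (at t within {a..b})"
    and bound: "\<And>t r. t \<in> {a..b} \<Longrightarrow> r > 0 \<Longrightarrow> \<bar>V' t\<bar> \<le> (r * (n * E t) + V t / r) / 4"
    and n: "0 \<le> n"
  shows "\<bar>sqrt (V b) - sqrt (V a)\<bar> \<le> sqrt n / 4 * integral {a..b} (\<lambda>t. sqrt (E t))"
proof -
  let ?I = "integral {a..b} (\<lambda>t. sqrt n / 4 * sqrt (E t))"
  \<comment> \<open>Eliminating the free \<open>r\<close>, with coefficients \<open>n * E t\<close>
    and \<open>V t\<close>, restores a product of square roots.\<close>
  have bound': "\<bar>V' t\<bar> \<le> sqrt n * sqrt (E t) * sqrt (V t) / 2" if "t \<in> {a..b}" for t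
  proof -
    have "4 * \<bar>V' t\<bar> \<le> 2 * sqrt ((n * E t) * V t)"
      by (rule le_sqrt_if_le_all_scalings) (use that V E n bound[OF that] in \<open>auto simp: field_simps\<close>)
    then show ?thesis by (simp add: real_sqrt_mult)
  qed
  have *: "\<bar>sqrt (V b + e) - sqrt (V a + e)\<bar> \<le> ?I" if e: "e > 0" for e
  proof -
    define W' where "W' t = inverse (sqrt (V t + e)) / 2 * V' t" for t
    have "((\<lambda>t. sqrt (V t + e)) has_real_derivative W' t) (at t within {a..b})" if "t \<in> {a..b}" for t
      unfolding W'_def
      by (rule DERIV_chain2[where f = sqrt, OF DERIV_real_sqrt])
        (use V[OF that] e deriv[OF that] in \<open>auto intro!: derivative_eq_intros\<close>)
    then have W: "(W' has_integral (sqrt (V b + e) - sqrt (V a + e))) {a..b}"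
      using ab by (intro fundamental_theorem_of_calculus)
        (auto simp: has_real_derivative_iff_has_vector_derivative)
    have "norm (integral {a..b} W') \<le> ?I"
    proof (rule integral_norm_bound_integral)
      show "W' integrable_on {a..b}" using W by (rule has_integral_integrable)
      show "(\<lambda>t. sqrt n / 4 * sqrt (E t)) integrable_on {a..b}"
        by (intro integrable_continuous_real continuous_intros E(2))
      show "norm (W' t) \<le> sqrt n / 4 * sqrt (E t)" if t: "t \<in> {a..b}" for t
      proof -
        have pos: "sqrt (V t + e) > 0" using V[OF t] e by simp
        \<comment> \<open>Adding \<open>e\<close> enlarges the bound so that its last factor cancels
          the denominator of \<open>W' t\<close>; the 1/2 in \<open>W' t\<close> turns 1/2 into
          1/4.\<close>
        have "\<bar>V' t\<bar> \<le> sqrt n * sqrt (E t) * sqrt (V t + e) / 2"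
          using bound'[OF t] E(1)[OF t] n e
          by (smt (verit) mult_left_mono mult_nonneg_nonneg real_sqrt_ge_zero real_sqrt_le_mono divide_right_mono)
        then show ?thesis
          using pos by (simp add: W'_def abs_mult field_simps)
      qed
    qed
    then show ?thesis using W by (simp add: integral_unique)
  qed
  have "((\<lambda>e. \<bar>sqrt (V b + e) - sqrt (V a + e)\<bar>) \<longlongrightarrow> \<bar>sqrt (V b + 0) - sqrt (V a + 0)\<bar>) (at_right 0)"
    by (intro tendsto_intros)
  moreover have "\<forall>\<^sub>F e in at_right 0. \<bar>sqrt (V b + e) - sqrt (V a + e)\<bar> \<le> ?I"
    using * by (intro eventually_at_rightI[of 0 1]) auto
  ultimately have "\<bar>sqrt (V b + 0) - sqrt (V a + 0)\<bar> \<le> ?I"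
    by (rule tendsto_upperbound) simp
  then show ?thesis by simp
qed

section \<open>Smooth tensor fields in charts\<close>

text \<open>Coordinate expressions carry no meaning off the chart image. On an open set the
  derivative depends only on nearby values, so equality there survives every further
  differentiation.\<close>

lemma iter_partial_cong:
  assumes "open S" "\<And>x. x \<in> S \<Longrightarrow> f x = g x" "x \<in> S"
  shows "iter_partial is f x = iter_partial is g x"
  using assms(2,3)
proof (induction "is" arbitrary: f g x)
  case (Cons i "is")
  have "frechet_derivative f (at y) = frechet_derivative g (at y)" if "y \<in> S" for y
  proof -
    have "(f has_derivative D) (at y) \<longleftrightarrow> (g has_derivative D) (at y)" for D
      using has_derivative_transform_within_open[of f D y UNIV S g]
        has_derivative_transform_within_open[of g D y UNIV S f] that assms(1) Cons.prems(1) by auto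
    then show ?thesis by (simp add: frechet_derivative_def)
  qed
  then have "iter_partial is (\<lambda>x. frechet_derivative f (at x) (axis i 1)) x
      = iter_partial is (\<lambda>x. frechet_derivative g (at x) (axis i 1)) x"
    by (intro Cons.IH Cons.prems) simp
  then show ?case by simp
qed simp

lemma smooth_on_partial:
  assumes "smooth_on S f"
  shows "smooth_on S (\<lambda>x. frechet_derivative f (at x) (axis i 1))"
  unfolding smooth_on_def
proof
  fix "is"
  have "iter_partial (i # is) f differentiable_on S"
    using assms by (simp only: smooth_on_def)
  then show "iter_partial is (\<lambda>x. frechet_derivative f (at x) (axis i 1)) differentiable_on S"
    by simp
qed

lemma smooth_on_imp_differentiable_on: "smooth_on S f \<Longrightarrow> f differentiable_on S"
  unfolding smooth_on_def by (metis iter_partial.simps(1))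

lemma smooth_on_imp_continuous_on: "smooth_on S f \<Longrightarrow> continuous_on S f"
  by (simp add: differentiable_imp_continuous_on smooth_on_imp_differentiable_on)

text \<open>Linearity of the derivative is available only on \<open>S\<close>, where both functions
  are differentiable; \<open>iter_partial_cong\<close> carries the identity on \<open>S\<close>
  through the remaining derivatives.\<close>

lemma iter_partial_lincomb:
  assumes S: "open S" and "smooth_on S f" "smooth_on S g" "x \<in> S"
  shows "iter_partial is (\<lambda>x. a *\<^sub>R f x + b *\<^sub>R g x) x
    = a *\<^sub>R iter_partial is f x + b *\<^sub>R iter_partial is g x"
  using assms(2-)
proof (induction "is" arbitrary: f g x)
  case (Cons i "is")
  have "frechet_derivative (\<lambda>x. a *\<^sub>R f x + b *\<^sub>R g x) (at y) (axis i 1)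
      = a *\<^sub>R frechet_derivative f (at y) (axis i 1) + b *\<^sub>R frechet_derivative g (at y) (axis i 1)"
    if "y \<in> S" for y
  proof -
    have "f differentiable at y" "g differentiable at y"
      using Cons.prems smooth_on_imp_differentiable_on S that
      by (metis at_within_open differentiable_on_def)+
    then have "((\<lambda>x. a *\<^sub>R f x + b *\<^sub>R g x) has_derivative
        (\<lambda>v. a *\<^sub>R frechet_derivative f (at y) v + b *\<^sub>R frechet_derivative g (at y) v)) (at y)"
      by (intro derivative_intros) (simp_all flip: frechet_derivative_works)
    from fun_cong[OF frechet_derivative_at[OF this], of "axis i 1"] show ?thesis by simp
  qed
  then have "iter_partial is (\<lambda>y. frechet_derivative (\<lambda>x. a *\<^sub>R f x + b *\<^sub>R g x) (at y) (axis i 1)) x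
      = iter_partial is (\<lambda>y. a *\<^sub>R frechet_derivative f (at y) (axis i 1)
          + b *\<^sub>R frechet_derivative g (at y) (axis i 1)) x"
    by (intro iter_partial_cong[OF S] Cons.prems)
  then show ?case
    using Cons.IH[OF smooth_on_partial smooth_on_partial] Cons.prems by simp
qed simp

lemma smooth_on_lincomb:
  assumes "open S" "smooth_on S f" "smooth_on S g"
  shows "smooth_on S (\<lambda>x. a *\<^sub>R f x + b *\<^sub>R g x)"
  unfolding smooth_on_def
proof
  fix "is"
  have "iter_partial is f differentiable_on S" "iter_partial is g differentiable_on S"
    using assms by (simp_all add: smooth_on_def)
  then have comb: "(\<lambda>x. a *\<^sub>R iter_partial is f x + b *\<^sub>R iter_partial is g x) differentiable_on S"
    by (auto intro!: derivative_intros simp: differentiable_on_def)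
  show "iter_partial is (\<lambda>x. a *\<^sub>R f x + b *\<^sub>R g x) differentiable_on S"
    unfolding differentiable_on_def
  proof
    fix x assume x: "x \<in> S"
    obtain D where D: "((\<lambda>x. a *\<^sub>R iter_partial is f x + b *\<^sub>R iter_partial is g x) has_derivative D)
        (at x within S)"
      using comb x unfolding differentiable_on_def differentiable_def by blast
    have "(iter_partial is (\<lambda>x. a *\<^sub>R f x + b *\<^sub>R g x) has_derivative D) (at x within S)"
      by (rule has_derivative_transform[OF x _ D]) (rule iter_partial_lincomb[OF assms])
    then show "iter_partial is (\<lambda>x. a *\<^sub>R f x + b *\<^sub>R g x) differentiable at x within S"
      unfolding differentiable_def by (rule exI[of _ D])
  qed
qed

section \<open>Charts, tensor fields and the convex set of metrics\<close>

context oriented_manifold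
begin

lemma dom_subset: "c \<in> A \<Longrightarrow> dom_of c \<subseteq> topspace X"
  using open_domain openin_subset by blast

lemma inj_on_coord:
  assumes "c \<in> A"
  shows "inj_on (coord c) (dom_of c)"
  using homeomorphic_imp_injective_map[OF homeo[OF assms]] dom_subset[OF assms]
  by (simp add: inf.absorb2)

lemma coord_inv_coord: "c \<in> A \<Longrightarrow> p \<in> dom_of c \<Longrightarrow> coord_inv c (coord c p) = p"
  by (simp add: coord_inv_def inj_on_coord)

lemma coord_inv_in_dom: "x \<in> coord c ` dom_of c \<Longrightarrow> coord_inv c x \<in> dom_of c"
  by (simp add: coord_inv_def inv_into_into)

lemma open_coord_image:
  assumes c: "c \<in> A" and W: "openin X W"
  shows "open (coord c ` (W \<inter> dom_of c))"
proof -
  have "openin (subtopology X (dom_of c)) (W \<inter> dom_of c)"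
    using W by (rule openin_subtopology_Int)
  then have "openin (top_of_set (coord c ` dom_of c)) (coord c ` (W \<inter> dom_of c))"
    using homeomorphic_imp_open_map[OF homeo[OF c]] by (simp add: open_map_def)
  then show ?thesis
    using open_image[OF c] by (simp add: openin_open_eq)
qed

lemma openin_coord_preimage:
  assumes c: "c \<in> A" and U: "open U"
  shows "openin X {p \<in> dom_of c. coord c p \<in> U}"
proof -
  have "openin (subtopology X (dom_of c))
      {p \<in> topspace (subtopology X (dom_of c)). coord c p \<in> coord c ` dom_of c \<inter> U}"
    using homeomorphic_imp_continuous_map[OF homeo[OF c]] U
    by (intro openin_continuous_map_preimage[where Y = "top_of_set (coord c ` dom_of c)"])
      (auto simp: openin_open)
  moreover have "{p \<in> topspace (subtopology X (dom_of c)). coord c p \<in> coord c ` dom_of c \<inter> U}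
      = {p \<in> dom_of c. coord c p \<in> U}"
    using dom_subset[OF c] by auto
  ultimately show ?thesis
    using openin_open_subtopology[OF open_domain[OF c]] by auto
qed

text \<open>Some closed ball around the coordinates of \<open>p\<close> fits into the open chart
  image; its open ball is pulled back to \<open>W\<close>, and the closed ball is
  \<open>K\<close>.\<close>

lemma openin_relatively_compact_in_chart:
  assumes "p \<in> topspace X"
  obtains c W K where "c \<in> A" "openin X W" "p \<in> W" "W \<subseteq> dom_of c"
    "compact K" "coord c ` W \<subseteq> K" "K \<subseteq> coord c ` dom_of c"
proof -
  obtain c where c: "c \<in> A" "p \<in> dom_of c"
    using assms unfolding covers[symmetric] by blast
  then obtain e where e: "e > 0" "cball (coord c p) e \<subseteq> coord c ` dom_of c"
    using open_image[OF c(1)] by (meson image_eqI open_contains_cball)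
  show ?thesis
  proof (rule that[OF c(1) openin_coord_preimage[OF c(1) open_ball] _ _ compact_cball])
    show "p \<in> {q \<in> dom_of c. coord c q \<in> ball (coord c p) e}" using c e by simp
    show "coord c ` {q \<in> dom_of c. coord c q \<in> ball (coord c p) e} \<subseteq> cball (coord c p) e"
      by auto
  qed (use e in auto)
qed

text \<open>All defining conditions are linear in the components; only smoothness of the combination
  calls on analysis.\<close>

lemma sym_tensors_lincomb:
  assumes h: "h \<in> sym_tensors A" and k: "k \<in> sym_tensors A"
  shows "(\<lambda>c p. a *\<^sub>R h c p + b *\<^sub>R k c p) \<in> sym_tensors A"
proof -
  have tr: "transpose (a *\<^sub>R M + b *\<^sub>R N) = a *\<^sub>R transpose M + b *\<^sub>R transpose N" for M N :: "real^'n^'n"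
    by (simp add: transpose_def vec_eq_iff)
  have mm: "transpose J ** (a *\<^sub>R M + b *\<^sub>R N) ** J
      = a *\<^sub>R (transpose J ** M ** J) + b *\<^sub>R (transpose J ** N ** J)" for J M N :: "real^'n^'n"
    by (simp add: matrix_add_ldistrib matrix_mult_add_left matrix_mult_scaleR)
  show ?thesis
    unfolding sym_tensors_def
  proof (intro CollectI conjI ballI)
    fix c d p
    assume *: "c \<in> A" "d \<in> A" "p \<in> dom_of c \<inter> dom_of d"
    have "h c p = transpose (jacobian c d p) ** h d p ** jacobian c d p"
      "k c p = transpose (jacobian c d p) ** k d p ** jacobian c d p"
      using h k * unfolding sym_tensors_def by blast+
    then show "a *\<^sub>R h c p + b *\<^sub>R k c p
        = transpose (jacobian c d p) ** (a *\<^sub>R h d p + b *\<^sub>R k d p) ** jacobian c d p"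
      unfolding mm by simp
  next
    fix c assume c: "c \<in> A"
    show "smooth_on (coord c ` dom_of c) (\<lambda>x. a *\<^sub>R h c (coord_inv c x) + b *\<^sub>R k c (coord_inv c x))"
      using h k c by (intro smooth_on_lincomb open_image) (simp_all add: sym_tensors_def)
    fix p assume p: "p \<in> dom_of c"
    have "transpose (h c p) = h c p" "transpose (k c p) = k c p"
      using h k c p unfolding sym_tensors_def by blast+
    then show "transpose (a *\<^sub>R h c p + b *\<^sub>R k c p) = a *\<^sub>R h c p + b *\<^sub>R k c p"
      by (simp add: tr)
  next
    show "\<forall>c p. \<not> (c \<in> A \<and> p \<in> dom_of c) \<longrightarrow> a *\<^sub>R h c p + b *\<^sub>R k c p = 0"
      using h k by (simp add: sym_tensors_def)
  qed
qed

lemma riem_metrics_convex: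
  assumes g: "g0 \<in> riem_metrics A" "g1 \<in> riem_metrics A" and t: "0 \<le> t" "t \<le> 1"
  shows "(\<lambda>c p. (1 - t) *\<^sub>R g0 c p + t *\<^sub>R g1 c p) \<in> riem_metrics A"
proof -
  have "0 < v \<bullet> (((1 - t) *\<^sub>R g0 c p + t *\<^sub>R g1 c p) *v v)"
    if "c \<in> A" "p \<in> dom_of c" "v \<noteq> 0" for c p v
  proof -
    have pos: "0 < v \<bullet> (g0 c p *v v)" "0 < v \<bullet> (g1 c p *v v)"
      using g that by (auto simp: riem_metrics_def)
    have "0 < (1 - t) * (v \<bullet> (g0 c p *v v)) + t * (v \<bullet> (g1 c p *v v))"
      using pos t by (cases "t = 0") (auto intro!: add_nonneg_pos)
    then show ?thesis
      by (simp add: matrix_vector_mult_add_rdistrib inner_add_right flip: scaleR_matrix_vector_assoc)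
  qed
  then show ?thesis
    using g sym_tensors_lincomb by (auto simp: riem_metrics_def)
qed

lemma continuous_on_tensor:
  assumes "h \<in> sym_tensors A" "c \<in> A"
  shows "continuous_on (coord c ` dom_of c) (\<lambda>x. h c (coord_inv c x))"
  using assms by (intro smooth_on_imp_continuous_on) (simp add: sym_tensors_def)

text \<open>The infimum defining the distance says something only if a path exists. On the segment
  from \<open>g0\<close> to \<open>g1\<close> every difference quotient equals
  \<open>g1 - g0\<close>, so the convergence is trivial.\<close>

lemma metric_paths_nonempty:
  assumes g: "g0 \<in> riem_metrics A" "g1 \<in> riem_metrics A"
  shows "metric_paths A g0 g1 \<noteq> {}"
proof -
  define \<gamma> where "\<gamma> t = (\<lambda>c p. (1 - t) *\<^sub>R g0 c p + t *\<^sub>R g1 c p)" for t :: real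
  define h where "h = (\<lambda>c p. (-1) *\<^sub>R g0 c p + 1 *\<^sub>R g1 c p)"
  have "h \<in> sym_tensors A"
    unfolding h_def using g by (intro sym_tensors_lincomb) (auto simp: riem_metrics_def)
  moreover have "(\<gamma> s c p - \<gamma> t c p) /\<^sub>R (s - t) = h c p" if "s \<noteq> t" for s t c p
  proof -
    have "\<gamma> s c p - \<gamma> t c p = (s - t) *\<^sub>R h c p"
      by (simp add: \<gamma>_def h_def algebra_simps)
    then show ?thesis using that by simp
  qed
  ultimately have "tensor_has_derivative A \<gamma> h t {0..1}" for t
    unfolding tensor_has_derivative_def tensor_tendsto_def uniform_limit_iff
    by (auto simp: eventually_at_filter intro!: always_eventually)
  moreover have "tensor_tendsto A (\<lambda>_. h) h F" for F :: "real filter"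
    by (simp add: tensor_tendsto_def uniform_limit_const)
  ultimately have "tensor_C1_on A {0..1} \<gamma>"
    unfolding tensor_C1_on_def by (intro exI[of _ "\<lambda>_. h"]) simp
  moreover have "\<gamma> 0 = g0" "\<gamma> 1 = g1" by (simp_all add: \<gamma>_def)
  moreover have "\<gamma> t \<in> riem_metrics A" if "t \<in> {0..1}" for t
    unfolding \<gamma>_def using that by (intro riem_metrics_convex g) auto
  \<comment> \<open>The subdivision is the single interval from 0 to 1: one piece, with
    \<open>real\<close> as the sequence of break points.\<close>
  ultimately have "\<gamma> \<in> metric_paths A g0 g1"
    unfolding metric_paths_def by (auto intro!: exI[of _ "1::nat"] exI[of _ real])
  then show ?thesis by blast
qed

end

text \<open>Cover \<open>M\<close> by finitely many relatively compact open sets, merge those belonging to the same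
  chart, and make the result disjoint by subtracting predecessors in an enumeration.\<close>

lemma (in closed_oriented_manifold) chart_partition_exists:
  "\<exists>C B. chart_partition A C B"
proof -
  define good where "good W c K \<longleftrightarrow> c \<in> A \<and> W \<subseteq> dom_of c \<and>
    compact K \<and> coord c ` W \<subseteq> K \<and> K \<subseteq> coord c ` dom_of c" for W c K
  define \<W> where "\<W> = {W. openin X W \<and> (\<exists>c K. good W c K)}"
  have "topspace X \<subseteq> \<Union>\<W>"
  proof
    fix p assume "p \<in> topspace X"
    then obtain c W K where "c \<in> A" "openin X W" "p \<in> W" "W \<subseteq> dom_of c"
      "compact K" "coord c ` W \<subseteq> K" "K \<subseteq> coord c ` dom_of c"
      by (rule openin_relatively_compact_in_chart)
    then have "good W c K" by (simp add: good_def)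
    with \<open>openin X W\<close> have "W \<in> \<W>" unfolding \<W>_def by blast
    then show "p \<in> \<Union>\<W>" using \<open>p \<in> W\<close> by blast
  qed
  then obtain \<F> where \<F>: "finite \<F>" "\<F> \<subseteq> \<W>" "topspace X \<subseteq> \<Union>\<F>"
    using compact[unfolded compact_space_alt, rule_format, of \<W>] unfolding \<W>_def by blast
  then have "\<forall>W\<in>\<F>. \<exists>c K. good W c K"
    by (auto simp: \<W>_def)
  then obtain ch K where good: "\<And>W. W \<in> \<F> \<Longrightarrow> good W (ch W) (K W)"
    by metis
  define C where "C = ch ` \<F>"
  define V where "V c = \<Union>{W \<in> \<F>. ch W = c}" for c
  have "finite C" using \<F>(1) by (simp add: C_def)
  then obtain idx :: "('m, 'n) chart \<Rightarrow> nat" where idx: "inj_on idx C"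
    using finite_imp_inj_to_nat_seg by blast
  define P where "P c = (\<Union>d\<in>{d \<in> C. idx d < idx c}. V d)" for c
  define B where "B c = V c - P c" for c
  have V_open: "openin X (V c)" for c
    using \<F>(2) by (auto simp: V_def \<W>_def)
  have P_open: "openin X (P c)" for c
    using V_open by (auto simp: P_def)
  have V_dom: "V c \<subseteq> dom_of c" for c
    using good by (auto simp: V_def good_def)
  have "chart_partition A C B"
    unfolding chart_partition_def
  proof (intro conjI ballI)
    show "C \<subseteq> A" using good by (auto simp: C_def good_def)
    show "disjoint_family_on B C"
      unfolding disjoint_family_on_def
    proof (intro ballI impI)
      fix c d assume cd: "c \<in> C" "d \<in> C" "c \<noteq> d"
      then have "idx c < idx d \<or> idx d < idx c"
        using idx by (meson inj_onD linorder_neqE_nat)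
      then show "B c \<inter> B d = {}" using cd by (auto simp: B_def P_def)
    qed
    show "(\<Union>c\<in>C. B c) = (\<Union>c\<in>A. dom_of c)"
    proof
      show "(\<Union>c\<in>C. B c) \<subseteq> (\<Union>c\<in>A. dom_of c)"
        using \<open>C \<subseteq> A\<close> V_dom unfolding B_def by blast
      show "(\<Union>c\<in>A. dom_of c) \<subseteq> (\<Union>c\<in>C. B c)"
      proof
        fix p assume "p \<in> (\<Union>c\<in>A. dom_of c)"
        then obtain W where W: "W \<in> \<F>" "p \<in> W" using covers \<F>(3) by auto
        then have "ch W \<in> C \<and> p \<in> V (ch W)" by (auto simp: C_def V_def)
        \<comment> \<open>Among the charts whose \<open>V\<close> contains \<open>p\<close>, the one
          of least index keeps \<open>p\<close> after the predecessors are removed.\<close>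
        from ex_has_least_nat[of "\<lambda>c. c \<in> C \<and> p \<in> V c", OF this, of idx]
        obtain c where "c \<in> C" "p \<in> V c" "\<And>d. d \<in> C \<Longrightarrow> p \<in> V d \<Longrightarrow> idx c \<le> idx d"
          by blast
        then show "p \<in> (\<Union>c\<in>C. B c)"
          by (force simp: B_def P_def)
      qed
    qed
    fix c assume c: "c \<in> C"
    show "B c \<subseteq> dom_of c" using V_dom unfolding B_def by blast
    show "\<exists>L. compact L \<and> coord c ` B c \<subseteq> L \<and> L \<subseteq> coord c ` dom_of c"
    proof (intro exI conjI)
      show "compact (\<Union>W\<in>{W \<in> \<F>. ch W = c}. K W)"
        using \<F>(1) good by (intro compact_UN) (auto simp: good_def)
      show "coord c ` B c \<subseteq> (\<Union>W\<in>{W \<in> \<F>. ch W = c}. K W)"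
        using good by (fastforce simp: good_def B_def V_def)
      show "(\<Union>W\<in>{W \<in> \<F>. ch W = c}. K W) \<subseteq> coord c ` dom_of c"
        using good by (fastforce simp: good_def)
    qed
    fix d assume d: "d \<in> A"
    \<comment> \<open>The injective chart map carries a difference of open sets to a difference of
      open sets, which is Borel.\<close>
    have "coord d ` (B c \<inter> dom_of d) = coord d ` (V c \<inter> dom_of d) - coord d ` (P c \<inter> dom_of d)"
      using inj_on_image_set_diff[OF inj_on_coord[OF d], of "V c \<inter> dom_of d" "P c \<inter> dom_of d"]
      by (simp add: B_def Diff_Int_distrib2 le_infI1 Diff_subset subset_iff)
    then show "coord d ` (B c \<inter> dom_of d) \<in> sets lebesgue"
      using open_coord_image[OF d V_open] open_coord_image[OF d P_open]
      by (simp add: sets.Diff lebesgue_openin borel_open)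
  qed (use \<open>finite C\<close> in auto)
  then show ?thesis by blast
qed

section \<open>Variation of the volume\<close>

text \<open>All the analysis on one chart piece: \<open>R\<close> is the coordinate image of the
  piece and \<open>S\<close> that of its part in Y. Here \<open>v\<close> is the volume density,
  \<open>w\<close> its time derivative and \<open>e\<close> the energy density. The last bound is
  linear in the integrals of \<open>e\<close> and \<open>v\<close>.\<close>

lemma chart_estimates:
  fixes G H :: "real \<Rightarrow> real^'n \<Rightarrow> real^'n^'n"
  assumes K: "compact K" "S \<in> sets lebesgue" "R \<in> sets lebesgue" "S \<subseteq> R" "R \<subseteq> K"
    and contG: "\<And>t. t \<in> {a..b} \<Longrightarrow> continuous_on K (G t)"
    and contH: "\<And>t. t \<in> {a..b} \<Longrightarrow> continuous_on K (H t)"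
    and Glim: "\<And>t. t \<in> {a..b} \<Longrightarrow>
      uniform_limit K (\<lambda>s x. (G s x - G t x) /\<^sub>R (s - t)) (H t) (at t within {a..b})"
    and Hlim: "\<And>t. t \<in> {a..b} \<Longrightarrow> uniform_limit K H (H t) (at t within {a..b})"
    and Gsym: "\<And>t x. t \<in> {a..b} \<Longrightarrow> x \<in> K \<Longrightarrow> transpose (G t x) = G t x"
    and Gpos: "\<And>t x v. t \<in> {a..b} \<Longrightarrow> x \<in> K \<Longrightarrow> v \<noteq> 0 \<Longrightarrow> 0 < v \<bullet> (G t x *v v)"
    and Hsym: "\<And>t x. t \<in> {a..b} \<Longrightarrow> x \<in> K \<Longrightarrow> transpose (H t x) = H t x"
  defines "v \<equiv> \<lambda>t x. sqrt (det (G t x))"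
    and "w \<equiv> \<lambda>t x. trace (matrix_inv (G t x) ** H t x) * sqrt (det (G t x)) / 2"
    and "e \<equiv> \<lambda>t x. trace (matrix_inv (G t x) ** H t x ** matrix_inv (G t x) ** H t x)
      * sqrt (det (G t x))"
  shows "\<And>t. t \<in> {a..b} \<Longrightarrow> ((\<lambda>s. LINT x:S|lebesgue. v s x) has_real_derivative
      (LINT x:S|lebesgue. w t x)) (at t within {a..b})"
    and "continuous_on {a..b} (\<lambda>t. LINT x:R|lebesgue. e t x)"
    and "\<And>t. t \<in> {a..b} \<Longrightarrow> 0 \<le> (LINT x:S|lebesgue. v t x)"
    and "\<And>t. t \<in> {a..b} \<Longrightarrow> 0 \<le> (LINT x:R|lebesgue. e t x)"
    and "\<And>t r. t \<in> {a..b} \<Longrightarrow> r > 0 \<Longrightarrow> \<bar>LINT x:S|lebesgue. w t x\<bar>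
      \<le> (r * (real CARD('n) * (LINT x:R|lebesgue. e t x)) + (LINT x:S|lebesgue. v t x) / r) / 4"
proof -
  note lim = uniform_quotient_limit[OF K(1) contG contH Glim Hlim]
  have SK: "S \<subseteq> K" using K by blast
  have det: "0 < det (G t x)" if "t \<in> {a..b}" "x \<in> K" for t x
    using pos_def_det_pos Gpos that by blast
  have cG: "continuous_on ({a..b} \<times> K) (\<lambda>p. G (fst p) (snd p))"
    and cH: "continuous_on ({a..b} \<times> K) (\<lambda>p. H (fst p) (snd p))"
    using lim(1,2) by (simp_all add: case_prod_unfold)
  have cI: "continuous_on ({a..b} \<times> K) (\<lambda>p. matrix_inv (G (fst p) (snd p)))"
    by (rule continuous_on_matrix_inv[OF cG]) (use det in force)
  have cv: "continuous_on ({a..b} \<times> K) (\<lambda>(t, x). v t x)"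
    and cw: "continuous_on ({a..b} \<times> K) (\<lambda>(t, x). w t x)"
    and ce: "continuous_on ({a..b} \<times> K) (\<lambda>(t, x). e t x)"
    unfolding v_def w_def e_def case_prod_unfold
    by (intro continuous_intros continuous_on_det continuous_on_trace continuous_on_matrix_mult
        cG cH cI; simp)+
  show "((\<lambda>s. LINT x:S|lebesgue. v s x) has_real_derivative (LINT x:S|lebesgue. w t x))
      (at t within {a..b})" if "t \<in> {a..b}" for t
  proof (rule has_real_derivative_set_lebesgue_integral[OF that K(1,2) SK _ cw])
    show "continuous_on K (v s)" if "s \<in> {a..b}" for s
      using continuous_on_case_prodD(1)[OF cv that] .
    show "((\<lambda>s. v s x) has_real_derivative w s x) (at s within {a..b})"
      if "s \<in> {a..b}" "x \<in> K" for s x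
      unfolding v_def w_def by (rule has_real_derivative_sqrt_det) (use lim(3) det that in auto)
  qed
  show "continuous_on {a..b} (\<lambda>t. LINT x:R|lebesgue. e t x)"
    by (rule continuous_on_set_lebesgue_integral[OF compact_Icc K(1,3,5) ce])
  have v0: "0 \<le> v t x" if "t \<in> {a..b}" "x \<in> K" for t x
    using det[OF that] by (simp add: v_def)
  have tr: "(trace (matrix_inv (G t x) ** H t x))\<^sup>2 * v t x \<le> real CARD('n) * e t x"
    if "t \<in> {a..b}" "x \<in> K" for t x
    using mult_right_mono[OF trace_square_le[OF Gsym[OF that] Gpos[OF that] Hsym[OF that]] v0[OF that]]
    by (simp add: e_def v_def mult_ac)
  \<comment> \<open>Nonnegativity of the energy density is read off the trace inequality, whose left
    side is a square times \<open>v\<close>.\<close>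
  have e0: "0 \<le> e t x" if "t \<in> {a..b}" "x \<in> K" for t x
  proof -
    have "0 \<le> real CARD('n) * e t x"
      using tr[OF that] v0[OF that] by (meson mult_nonneg_nonneg order_trans zero_le_power2)
    then show ?thesis by (simp add: zero_le_mult_iff)
  qed
  \<comment> \<open>Expand the square of r|u| - 1, divide by \<open>r\<close> and multiply by the
    density \<open>v\<close>; the trace inequality then replaces u*u*v by n*e. Since |w| = |u| v /
    2, the denominator is 4.\<close>
  have AMGM: "\<bar>w t x\<bar> \<le> (r * real CARD('n) * e t x + v t x / r) / 4"
    if "t \<in> {a..b}" "x \<in> K" "r > 0" for t x r
  proof -
    define u where "u = trace (matrix_inv (G t x) ** H t x)"
    have "0 \<le> (r * \<bar>u\<bar> - 1)\<^sup>2" by simp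
    then have "2 * r * \<bar>u\<bar> \<le> r\<^sup>2 * u\<^sup>2 + 1"
      by (simp add: power2_diff power_mult_distrib)
    then have "2 * \<bar>u\<bar> \<le> r * u\<^sup>2 + 1 / r"
      using that(3) by (simp add: field_simps power2_eq_square)
    from mult_right_mono[OF this v0[OF that(1,2)]]
    have "2 * \<bar>u\<bar> * v t x \<le> r * (u\<^sup>2 * v t x) + v t x / r"
      by (simp add: algebra_simps)
    also have "\<dots> \<le> r * (real CARD('n) * e t x) + v t x / r"
      using tr[OF that(1,2)] that(3) by (simp add: u_def)
    finally have "2 * \<bar>u\<bar> * v t x \<le> r * (real CARD('n) * e t x) + v t x / r" .
    moreover have "\<bar>w t x\<bar> = \<bar>u\<bar> * v t x / 2"
      using v0[OF that(1,2)] by (simp add: w_def u_def v_def abs_mult)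
    ultimately show ?thesis by (simp add: mult.assoc)
  qed
  show "0 \<le> (LINT x:S|lebesgue. v t x)" if "t \<in> {a..b}" for t
    using v0[OF that] SK unfolding set_lebesgue_integral_def
    by (intro integral_nonneg_AE AE_I2) (auto simp: indicator_def)
  show "0 \<le> (LINT x:R|lebesgue. e t x)" if "t \<in> {a..b}" for t
    using e0[OF that] K(5) unfolding set_lebesgue_integral_def
    by (intro integral_nonneg_AE AE_I2) (auto simp: indicator_def)
  show "\<bar>LINT x:S|lebesgue. w t x\<bar>
      \<le> (r * (real CARD('n) * (LINT x:R|lebesgue. e t x)) + (LINT x:S|lebesgue. v t x) / r) / 4"
    if t: "t \<in> {a..b}" and r: "r > 0" for t r
  proof -
    note int = set_integrable_continuous_compact[OF K(1) continuous_on_case_prodD(1)]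
    have iw: "set_integrable lebesgue S (w t)" and iv: "set_integrable lebesgue S (v t)"
      and ie: "set_integrable lebesgue S (e t)" and ieR: "set_integrable lebesgue R (e t)"
      by (rule int[OF cw t K(2) SK] int[OF cv t K(2) SK] int[OF ce t K(2) SK] int[OF ce t K(3,5)])+
    let ?q = "\<lambda>x. (r * real CARD('n) * e t x + v t x / r) / 4"
    have iq: "set_integrable lebesgue S ?q"
      by (intro set_integral_add set_integrable_divide set_integrable_mult_right iv ie)
    have "\<bar>LINT x:S|lebesgue. w t x\<bar> \<le> (LINT x:S|lebesgue. ?q x)"
    proof (rule abs_leI)
      show "(LINT x:S|lebesgue. w t x) \<le> (LINT x:S|lebesgue. ?q x)"
        by (rule set_integral_mono[OF iw iq]) (use AMGM[OF t _ r] SK in force)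
      have "(LINT x:S|lebesgue. - w t x) \<le> (LINT x:S|lebesgue. ?q x)"
        by (rule set_integral_mono[OF _ iq]) (use AMGM[OF t _ r] SK iw in \<open>force simp: set_integrable_def\<close>)+
      then show "- (LINT x:S|lebesgue. w t x) \<le> (LINT x:S|lebesgue. ?q x)"
        by (simp add: set_lebesgue_integral_def)
    qed
    also have "\<dots> = (r * real CARD('n) * (LINT x:S|lebesgue. e t x) + (LINT x:S|lebesgue. v t x) / r) / 4"
      using iv ie by (simp add: set_integral_add)
    \<comment> \<open>Here the energy passes from the part in Y to the whole piece, by
      \<open>e0\<close>.\<close>
    also have "(LINT x:S|lebesgue. e t x) \<le> (LINT x:R|lebesgue. e t x)"
      unfolding set_lebesgue_integral_def
      by (rule integral_mono) (use ie ieR e0[OF t] K(4,5) in \<open>auto simp: set_integrable_def indicator_def\<close>)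
    finally show ?thesis using r by (simp add: mult.assoc)
  qed
qed

section \<open>Passage from chart pieces to the manifold; the velocity of a path\<close>

lemma chart_partitionD:
  assumes "chart_partition A C B"
  shows "finite C" "C \<subseteq> A" "\<forall>c\<in>C. B c \<subseteq> dom_of c"
    "\<forall>c\<in>C. \<exists>K. compact K \<and> coord c ` B c \<subseteq> K \<and> K \<subseteq> coord c ` dom_of c"
    "\<forall>c\<in>C. \<forall>d\<in>A. coord d ` (B c \<inter> dom_of d) \<in> sets lebesgue"
  using assms by (simp_all add: chart_partition_def)

text \<open>The choice inside \<open>form_integral\<close> involves neither the form nor the set, so
  a single partition expresses the volume of Y and the energy on M at all times.\<close>

lemma (in closed_oriented_manifold) form_integral_eq_sum:
  obtains C B where "chart_partition A C B"
    and "\<And>\<omega> Y. form_integral A \<omega> Y =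
      (\<Sum>c\<in>C. LINT x : coord c ` (Y \<inter> B c) | lebesgue. \<omega> c (coord_inv c x))"
proof -
  define CB where "CB = (SOME (C, B). chart_partition A C B)"
  obtain C B where CB: "CB = (C, B)" by (cases CB)
  have "case CB of (C, B) \<Rightarrow> chart_partition A C B"
    unfolding CB_def by (rule someI_ex) (use chart_partition_exists in auto)
  then have "chart_partition A C B" by (simp add: CB)
  then show thesis
    by (rule that) (simp add: form_integral_def CB flip: CB_def)
qed

text \<open>The case of the empty list of partial derivatives, that is, uniform convergence of the
  components themselves.\<close>

lemma tensor_tendsto_uniform_limit:
  assumes "tensor_tendsto A f l F" "c \<in> A" "compact K" "K \<subseteq> coord c ` dom_of c"
  shows "uniform_limit K (\<lambda>s x. f s c (coord_inv c x)) (\<lambda>x. l c (coord_inv c x)) F"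
  using assms(1)[unfolded tensor_tendsto_def, rule_format, OF assms(2), of K "[]"] assms(3,4)
  by simp

lemma sym_tensors_transpose:
  "h \<in> sym_tensors A \<Longrightarrow> c \<in> A \<Longrightarrow> p \<in> dom_of c \<Longrightarrow> transpose (h c p) = h c p"
  unfolding sym_tensors_def by blast

lemma riem_metrics_pos:
  "g \<in> riem_metrics A \<Longrightarrow> c \<in> A \<Longrightarrow> p \<in> dom_of c \<Longrightarrow> v \<noteq> 0 \<Longrightarrow> 0 < v \<bullet> (g c p *v v)"
  by (simp add: riem_metrics_def)

text \<open>Uniform convergence on the one-point compact set \<open>{coord c p}\<close> is pointwise
  convergence, whose limit is unique; where components have no meaning both fields are 0 by
  convention.\<close>

lemma (in oriented_manifold) tensor_has_derivative_unique:
  assumes h: "tensor_has_derivative A \<gamma> h t T" and k: "tensor_has_derivative A \<gamma> k t T"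
    and t: "at t within T \<noteq> bot"
  shows "h = k"
proof (intro ext)
  fix c p
  show "h c p = k c p"
  proof (cases "c \<in> A \<and> p \<in> dom_of c")
    case True
    have lim: "((\<lambda>s. (\<gamma> s c p - \<gamma> t c p) /\<^sub>R (s - t)) \<longlongrightarrow> l c p) (at t within T)"
      if l: "tensor_has_derivative A \<gamma> l t T" for l
    proof -
      have "uniform_limit {coord c p}
          (\<lambda>s x. (\<gamma> s c (coord_inv c x) - \<gamma> t c (coord_inv c x)) /\<^sub>R (s - t))
          (\<lambda>x. l c (coord_inv c x)) (at t within T)"
        using l True unfolding tensor_has_derivative_def
        by (intro tensor_tendsto_uniform_limit[where A = A]) auto
      from tendsto_uniform_limitI[OF this, of "coord c p"] show ?thesis
        using True by (simp add: coord_inv_coord)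
    qed
    show ?thesis by (rule tendsto_unique[OF t lim[OF h] lim[OF k]])
  next
    case False
    have "l c p = 0" if "tensor_has_derivative A \<gamma> l t T" for l
      using that False unfolding tensor_has_derivative_def sym_tensors_def mem_Collect_eq by blast
    then show ?thesis using h k by metis
  qed
qed

text \<open>The velocity refers to the unit interval, the derivative of a C1 piece to
  \<open>{a..b}\<close>; strictly inside \<open>{a..b}\<close> both one-set filters are the full
  neighbourhood filter.\<close>

lemma (in oriented_manifold) tensor_velocity_eq:
  assumes "tensor_has_derivative A \<gamma> h t {a..b}" and t: "a < t" "t < b" and "{a..b} \<subseteq> {0..1}"
  shows "tensor_velocity A \<gamma> t = h"
proof -
  have "0 \<le> a" "b \<le> 1" using assms by auto
  then have "t \<in> interior {a..b}" "t \<in> interior {0..1}"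
    using t by auto
  then have "at t within {a..b} = at t" "at t within {0..1} = at t"
    by (simp_all only: at_within_interior)
  then have h: "tensor_has_derivative A \<gamma> h t {0..1}" and "at t within {0..1} \<noteq> bot"
    using assms(1) by (simp_all add: tensor_has_derivative_def)
  show ?thesis
    unfolding tensor_velocity_def
    by (rule the_equality[where a = h])
      (rule h, rule tensor_has_derivative_unique[OF _ h \<open>at t within {0..1} \<noteq> bot\<close>])
qed

section \<open>Change of the volume along a path, compared with the length of the path\<close>

context closed_oriented_manifold
begin

text \<open>Summing the chart estimates over the partition gives the hypotheses of
  \<open>sqrt_diff_le_integral\<close> for the total volume and energy. Integrability is stated as
  well because the pieces of a path are joined later.\<close>

lemma sqrt_Vol_diff_le_C1:
  assumes ab: "a \<le> b" and Y: "manifold_lebesgue_measurable X A Y"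
    and \<gamma>: "\<And>t. t \<in> {a..b} \<Longrightarrow> \<gamma> t \<in> riem_metrics A"
    and deriv: "\<And>t. t \<in> {a..b} \<Longrightarrow> tensor_has_derivative A \<gamma> (\<gamma>' t) t {a..b}"
    and cont: "\<And>t. t \<in> {a..b} \<Longrightarrow> tensor_tendsto A \<gamma>' (\<gamma>' t) (at t within {a..b})"
  shows "(\<lambda>t. sqrt (L2_inner A (\<gamma> t) (\<gamma>' t) (\<gamma>' t))) integrable_on {a..b}"
    and "\<bar>sqrt (Vol A Y (\<gamma> b)) - sqrt (Vol A Y (\<gamma> a))\<bar>
      \<le> sqrt (real CARD('n)) / 4 * integral {a..b} (\<lambda>t. sqrt (L2_inner A (\<gamma> t) (\<gamma>' t) (\<gamma>' t)))"
proof -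
  obtain C B where CB: "chart_partition A C B" and form_integral:
    "\<And>\<omega> Y. form_integral A \<omega> Y =
      (\<Sum>c\<in>C. LINT x : coord c ` (Y \<inter> B c) | lebesgue. \<omega> c (coord_inv c x))"
    by (rule form_integral_eq_sum) (rule that)
  note CBD = chart_partitionD[OF CB]
  have CA: "c \<in> A" and Bdom: "B c \<subseteq> dom_of c" if "c \<in> C" for c
    using CBD(2,3) that by auto
  from CBD(4) obtain K where K: "\<And>c. c \<in> C \<Longrightarrow> compact (K c)" "\<And>c. c \<in> C \<Longrightarrow> coord c ` B c \<subseteq> K c"
    "\<And>c. c \<in> C \<Longrightarrow> K c \<subseteq> coord c ` dom_of c"
    by metis
  define S where "S c = coord c ` (Y \<inter> B c)" for c
  define R where "R c = coord c ` B c" for c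
  have R_meas: "R c \<in> sets lebesgue" if "c \<in> C" for c
  proof -
    have "coord c ` (B c \<inter> dom_of c) \<in> sets lebesgue"
      using CBD(5) CA[OF that] that by simp
    then show ?thesis using Bdom[OF that] by (simp add: R_def Int_absorb2)
  qed
  \<comment> \<open>Injectivity of the chart turns the image of an intersection into the
    intersection of two measurable images.\<close>
  have S_meas: "S c \<in> sets lebesgue" if "c \<in> C" for c
  proof -
    have "S c = coord c ` ((Y \<inter> dom_of c) \<inter> B c)"
      unfolding S_def using Bdom[OF that] by (intro arg_cong[where f = "(`) (coord c)"]) blast
    also have "\<dots> = coord c ` (Y \<inter> dom_of c) \<inter> R c"
      unfolding R_def
      by (rule inj_on_image_Int[OF inj_on_coord[OF CA[OF that]]]) (use Bdom[OF that] in auto)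
    finally show ?thesis
      using Y CA[OF that] R_meas[OF that] unfolding manifold_lebesgue_measurable_def by auto
  qed
  define G where "G c t x = \<gamma> t c (coord_inv c x)" for c t x
  define H where "H c t x = \<gamma>' t c (coord_inv c x)" for c t x
  have \<gamma>_sym: "\<gamma> t \<in> sym_tensors A" and \<gamma>'_sym: "\<gamma>' t \<in> sym_tensors A" if "t \<in> {a..b}" for t
    using \<gamma>[OF that] deriv[OF that] by (simp_all add: riem_metrics_def tensor_has_derivative_def)
  have in_dom: "coord_inv c x \<in> dom_of c" if "c \<in> C" "x \<in> K c" for c x
    by (rule coord_inv_in_dom[OF subsetD[OF K(3)[OF that(1)] that(2)]])
  have tendsto0: "uniform_limit (K c) (\<lambda>s x. f s c (coord_inv c x)) (\<lambda>x. l c (coord_inv c x)) F"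
    if "tensor_tendsto A f l F" "c \<in> C" for f l c and F :: "real filter"
    using tensor_tendsto_uniform_limit[OF that(1) CA[OF that(2)] K(1,3)[OF that(2)]] .
  define v where "v c t x = sqrt (det (G c t x))" for c t x
  define w where "w c t x = trace (matrix_inv (G c t x) ** H c t x) * sqrt (det (G c t x)) / 2" for c t x
  define e where "e c t x = trace (matrix_inv (G c t x) ** H c t x ** matrix_inv (G c t x) ** H c t x)
      * sqrt (det (G c t x))" for c t x
  have est:
    "\<And>t. t \<in> {a..b} \<Longrightarrow> ((\<lambda>s. LINT x:S c|lebesgue. v c s x) has_real_derivative
      (LINT x:S c|lebesgue. w c t x)) (at t within {a..b})"
    "continuous_on {a..b} (\<lambda>t. LINT x:R c|lebesgue. e c t x)"
    "\<And>t. t \<in> {a..b} \<Longrightarrow> 0 \<le> (LINT x:S c|lebesgue. v c t x)"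
    "\<And>t. t \<in> {a..b} \<Longrightarrow> 0 \<le> (LINT x:R c|lebesgue. e c t x)"
    "\<And>t r. t \<in> {a..b} \<Longrightarrow> r > 0 \<Longrightarrow> \<bar>LINT x:S c|lebesgue. w c t x\<bar>
      \<le> (r * (real CARD('n) * (LINT x:R c|lebesgue. e c t x)) + (LINT x:S c|lebesgue. v c t x) / r) / 4"
    if c: "c \<in> C" for c
  proof -
    have SR: "S c \<subseteq> R c" "R c \<subseteq> K c"
      using K(2)[OF c] by (auto simp: S_def R_def)
    have G: "transpose (G c t x) = G c t x" "u \<noteq> 0 \<Longrightarrow> 0 < u \<bullet> (G c t x *v u)"
      if "t \<in> {a..b}" "x \<in> K c" for t x u
      using sym_tensors_transpose[OF \<gamma>_sym[OF that(1)] CA[OF c] in_dom[OF c that(2)]]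
        riem_metrics_pos[OF \<gamma>[OF that(1)] CA[OF c] in_dom[OF c that(2)]]
      by (simp_all add: G_def)
    have H: "transpose (H c t x) = H c t x" if "t \<in> {a..b}" "x \<in> K c" for t x
      using sym_tensors_transpose[OF \<gamma>'_sym[OF that(1)] CA[OF c] in_dom[OF c that(2)]]
      by (simp add: H_def)
    have contG: "continuous_on (K c) (G c t)" and contH: "continuous_on (K c) (H c t)"
      if "t \<in> {a..b}" for t
      using continuous_on_subset[OF continuous_on_tensor[OF \<gamma>_sym[OF that] CA[OF c]] K(3)[OF c]]
        continuous_on_subset[OF continuous_on_tensor[OF \<gamma>'_sym[OF that] CA[OF c]] K(3)[OF c]]
      unfolding G_def H_def by auto
    have Glim: "uniform_limit (K c) (\<lambda>s x. (G c s x - G c t x) /\<^sub>R (s - t)) (H c t) (at t within {a..b})"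
      and Hlim: "uniform_limit (K c) (H c) (H c t) (at t within {a..b})"
      if "t \<in> {a..b}" for t
      using tendsto0[OF _ c, OF conjunct2[OF deriv[OF that, unfolded tensor_has_derivative_def]]]
        tendsto0[OF cont[OF that] c]
      unfolding G_def H_def[abs_def] by simp_all
    note est = chart_estimates[where G = "G c" and H = "H c" and a = a and b = b,
        OF K(1)[OF c] S_meas[OF c] R_meas[OF c] SR contG contH Glim Hlim G(1) G(2) H,
        folded v_def w_def e_def]
    show "\<And>t. t \<in> {a..b} \<Longrightarrow> ((\<lambda>s. LINT x:S c|lebesgue. v c s x) has_real_derivative
      (LINT x:S c|lebesgue. w c t x)) (at t within {a..b})"
      by (rule est(1))
    show "continuous_on {a..b} (\<lambda>t. LINT x:R c|lebesgue. e c t x)"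
      by (rule est(2))
    show "\<And>t. t \<in> {a..b} \<Longrightarrow> 0 \<le> (LINT x:S c|lebesgue. v c t x)"
      by (rule est(3))
    show "\<And>t. t \<in> {a..b} \<Longrightarrow> 0 \<le> (LINT x:R c|lebesgue. e c t x)"
      by (rule est(4))
    show "\<And>t r. t \<in> {a..b} \<Longrightarrow> r > 0 \<Longrightarrow> \<bar>LINT x:S c|lebesgue. w c t x\<bar>
      \<le> (r * (real CARD('n) * (LINT x:R c|lebesgue. e c t x)) + (LINT x:S c|lebesgue. v c t x) / r) / 4"
      by (rule est(5))
  qed
  define V where "V t = (\<Sum>c\<in>C. LINT x:S c|lebesgue. v c t x)" for t
  define W where "W t = (\<Sum>c\<in>C. LINT x:S c|lebesgue. w c t x)" for t
  define E where "E t = (\<Sum>c\<in>C. LINT x:R c|lebesgue. e c t x)" for t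
  have V: "Vol A Y (\<gamma> t) = V t" for t
    by (simp add: Vol_def form_integral V_def S_def v_def G_def volume_form_def)
  have "(\<Union>c\<in>A. dom_of c) \<inter> B c = B c" if "c \<in> C" for c
    using Bdom[OF that] CA[OF that] by blast
  then have E: "L2_inner A (\<gamma> t) (\<gamma>' t) (\<gamma>' t) = E t" for t
    unfolding L2_inner_def form_integral E_def
    by (intro sum.cong) (simp_all add: R_def e_def[abs_def] G_def H_def volume_form_def)
  have contE: "continuous_on {a..b} E"
    unfolding E_def by (intro continuous_on_sum est(2))
  then show "(\<lambda>t. sqrt (L2_inner A (\<gamma> t) (\<gamma>' t) (\<gamma>' t))) integrable_on {a..b}"
    unfolding E by (intro integrable_continuous_real continuous_intros)
  show "\<bar>sqrt (Vol A Y (\<gamma> b)) - sqrt (Vol A Y (\<gamma> a))\<bar>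
      \<le> sqrt (real CARD('n)) / 4 * integral {a..b} (\<lambda>t. sqrt (L2_inner A (\<gamma> t) (\<gamma>' t) (\<gamma>' t)))"
    unfolding V E
  proof (rule sqrt_diff_le_integral[OF ab _ _ contE, where V' = W])
    fix t assume t: "t \<in> {a..b}"
    show "0 \<le> V t" "0 \<le> E t"
      unfolding V_def E_def using est(3,4) t by (auto intro!: sum_nonneg)
    show "(V has_real_derivative W t) (at t within {a..b})"
      unfolding V_def W_def using est(1) t by (intro DERIV_sum) auto
    fix r :: real assume r: "r > 0"
    have "\<bar>W t\<bar> \<le> (\<Sum>c\<in>C. \<bar>LINT x:S c|lebesgue. w c t x\<bar>)"
      unfolding W_def by (rule sum_abs)
    also have "\<dots> \<le> (\<Sum>c\<in>C. (r * (real CARD('n) * (LINT x:R c|lebesgue. e c t x))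
        + (LINT x:S c|lebesgue. v c t x) / r) / 4)"
      using est(5) t r by (intro sum_mono) auto
    also have "\<dots> = (r * (real CARD('n) * E t) + V t / r) / 4"
      unfolding E_def V_def
      by (simp add: sum.distrib sum_distrib_left flip: sum_divide_distrib)
    finally show "\<bar>W t\<bar> \<le> (r * (real CARD('n) * E t) + V t / r) / 4" .
  qed simp
qed

text \<open>Both sides are compatible with subdivision: the length integral is additive, and the
  root differences obey the triangle inequality.\<close>

lemma sqrt_Vol_diff_le_L2_length:
  assumes Y: "manifold_lebesgue_measurable X A Y" and \<gamma>: "\<gamma> \<in> metric_paths A g0 g1"
  shows "\<bar>sqrt (Vol A Y g1) - sqrt (Vol A Y g0)\<bar> \<le> sqrt (real CARD('n)) / 4 * L2_length A \<gamma>"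
proof -
  define L where "L t = sqrt (L2_inner A (\<gamma> t) (tensor_velocity A \<gamma> t) (tensor_velocity A \<gamma> t))" for t
  from \<gamma> obtain N \<tau> where ends: "\<gamma> 0 = g0" "\<gamma> 1 = g1" and \<gamma>_in: "\<And>t. t \<in> {0..1} \<Longrightarrow> \<gamma> t \<in> riem_metrics A"
    and \<tau>: "\<tau> 0 = 0" "\<tau> N = 1" "\<And>i. i < N \<Longrightarrow> \<tau> i < \<tau> (Suc i)"
    and C1: "\<And>i. i < N \<Longrightarrow> tensor_C1_on A {\<tau> i..\<tau> (Suc i)} \<gamma>"
    unfolding metric_paths_def by blast
  have \<tau>_mono: "\<tau> i \<le> \<tau> j" if "i \<le> j" "j \<le> N" for i j
    using that
  proof (induction j rule: dec_induct)
    case (step k)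
    then show ?case using \<tau>(3)[of k] by simp
  qed simp
  have piece: "\<exists>J. (L has_integral J) {\<tau> i..\<tau> (Suc i)} \<and>
      \<bar>sqrt (Vol A Y (\<gamma> (\<tau> (Suc i)))) - sqrt (Vol A Y (\<gamma> (\<tau> i)))\<bar> \<le> sqrt (real CARD('n)) / 4 * J"
    if i: "i < N" for i
  proof -
    let ?a = "\<tau> i" and ?b = "\<tau> (Suc i)"
    have sub: "{?a..?b} \<subseteq> {0..1}"
      using \<tau>_mono[of 0 i] \<tau>_mono[of "Suc i" N] i \<tau>(1,2) by auto
    obtain \<gamma>' where \<gamma>': "\<And>t. t \<in> {?a..?b} \<Longrightarrow> tensor_has_derivative A \<gamma> (\<gamma>' t) t {?a..?b}"
      "\<And>t. t \<in> {?a..?b} \<Longrightarrow> tensor_tendsto A \<gamma>' (\<gamma>' t) (at t within {?a..?b})"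
      using C1[OF i] unfolding tensor_C1_on_def by blast
    let ?L = "\<lambda>t. sqrt (L2_inner A (\<gamma> t) (\<gamma>' t) (\<gamma>' t))"
    have ab: "?a \<le> ?b" using \<tau>(3)[OF i] by simp
    have \<gamma>_ab: "\<gamma> t \<in> riem_metrics A" if "t \<in> {?a..?b}" for t
      using \<gamma>_in sub that by blast
    note C1_est = sqrt_Vol_diff_le_C1[OF ab Y \<gamma>_ab \<gamma>']
    have "(?L has_integral integral {?a..?b} ?L) {?a..?b}"
      using C1_est(1) by (rule integrable_integral)
    \<comment> \<open>The velocity agrees with the derivative of the piece except possibly at its
      two end points, which do not affect the integral.\<close>
    then have "(L has_integral integral {?a..?b} ?L) {?a..?b}"
    proof (rule has_integral_spike_finite[where S = "{?a, ?b}", rotated 2])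
      fix t assume t: "t \<in> {?a..?b} - {?a, ?b}"
      then have "tensor_velocity A \<gamma> t = \<gamma>' t"
        using sub by (intro tensor_velocity_eq[OF \<gamma>'(1)]) auto
      then show "L t = ?L t" by (simp add: L_def)
    qed simp
    then show ?thesis using C1_est(2) by blast
  qed
  \<comment> \<open>Keeping the value \<open>J\<close> with \<open>has_integral\<close> lets the
    induction over break points carry integrability and the estimate together.\<close>
  have "\<exists>J. (L has_integral J) {0..\<tau> i} \<and>
      \<bar>sqrt (Vol A Y (\<gamma> (\<tau> i))) - sqrt (Vol A Y (\<gamma> 0))\<bar> \<le> sqrt (real CARD('n)) / 4 * J"
    if "i \<le> N" for i
    using that
  proof (induction i)
    case 0
    show ?case using \<tau>(1) has_integral_refl(2)[of L 0] by (intro exI[of _ 0]) simp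
  next
    case (Suc i)
    then obtain J1 where J1: "(L has_integral J1) {0..\<tau> i}"
      "\<bar>sqrt (Vol A Y (\<gamma> (\<tau> i))) - sqrt (Vol A Y (\<gamma> 0))\<bar> \<le> sqrt (real CARD('n)) / 4 * J1"
      by auto
    obtain J2 where J2: "(L has_integral J2) {\<tau> i..\<tau> (Suc i)}"
      "\<bar>sqrt (Vol A Y (\<gamma> (\<tau> (Suc i)))) - sqrt (Vol A Y (\<gamma> (\<tau> i)))\<bar> \<le> sqrt (real CARD('n)) / 4 * J2"
      using piece[of i] Suc.prems by auto
    have "(L has_integral J1 + J2) {0..\<tau> (Suc i)}"
      using \<tau>_mono[of 0 i] \<tau>_mono[of i "Suc i"] Suc.prems \<tau>(1) J1(1) J2(1)
      by (intro has_integral_combine[where c = "\<tau> i"]) auto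
    moreover have "\<bar>sqrt (Vol A Y (\<gamma> (\<tau> (Suc i)))) - sqrt (Vol A Y (\<gamma> 0))\<bar>
        \<le> sqrt (real CARD('n)) / 4 * (J1 + J2)"
      using J1(2) J2(2) unfolding distrib_left by linarith
    ultimately show ?case by blast
  qed
  from this[of N] obtain J where "(L has_integral J) {0..1}"
    "\<bar>sqrt (Vol A Y g1) - sqrt (Vol A Y g0)\<bar> \<le> sqrt (real CARD('n)) / 4 * J"
    using \<tau>(2) ends by auto
  then show ?thesis
    by (simp add: L2_length_def integral_unique flip: L_def)
qed

end

theorem lemma3p3:
  fixes X :: "'m topology" and A :: "('m, 'n::finite) chart set"
    and g0 g1 :: "('m, 'n) components" and Y :: "'m set"
  assumes "closed_oriented_manifold X A"
    and "g0 \<in> riem_metrics A" and "g1 \<in> riem_metrics A"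
    and "manifold_lebesgue_measurable X A Y"
  shows "\<bar>sqrt (Vol A Y g1) - sqrt (Vol A Y g0)\<bar> \<le> sqrt (real CARD('n)) / 4 * L2_dist A g0 g1"
proof -
  interpret closed_oriented_manifold X A by fact
  define s where "s = sqrt (real CARD('n)) / 4"
  have s: "s > 0" by (simp add: s_def)
  \<comment> \<open>Dividing by the positive constant turns the estimate into a lower bound for all
    path lengths, hence for their infimum.\<close>
  have "\<bar>sqrt (Vol A Y g1) - sqrt (Vol A Y g0)\<bar> / s \<le> L2_dist A g0 g1"
    unfolding L2_dist_def
  proof (rule cInf_greatest)
    show "L2_length A ` metric_paths A g0 g1 \<noteq> {}"
      using metric_paths_nonempty[OF assms(2,3)] by simp
    fix l assume "l \<in> L2_length A ` metric_paths A g0 g1"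
    then show "\<bar>sqrt (Vol A Y g1) - sqrt (Vol A Y g0)\<bar> / s \<le> l"
      using sqrt_Vol_diff_le_L2_length[OF assms(4)] s
      by (auto simp: s_def[symmetric] pos_divide_le_eq mult.commute)
  qed
  then show ?thesis using s by (simp add: s_def[symmetric] pos_divide_le_eq mult.commute)
qed

end
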